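(* Over an algebraically closed field of characteristic different from $2$, the variety $\mathcal{T}_3$ of $3$-dimensional nilpotent Lie triple systems is irreducible: $\mathcal{T}_3=\overline{O(\mathcal{T}_{3,2})}$, so $\mathcal{T}_{3,2}$ is rigid, and $\dim O(\mathcal{T}_{3,2})=4$.
   Context: A Lie triple system is a finite-dimensional vector space with a trilinear map $[\cdot,\cdot,\cdot]$ satisfying (A1) $[x,y,z]+[y,x,z]=0$; (A2) $[x,y,z]+[y,z,x]+[z,x,y]=0$; (A3) $[u,v,[x,y,z]]=[[u,v,x],y,z]+[x,[u,v,y],z]+[x,y,[u,v,z]]$; nilpotent means $\mathcal{T}^{(m)}=0$ for some $m$, with $\mathcal{T}^{(0)}=\mathcal{T}$, $\mathcal{T}^{(n+1)}=[\mathcal{T}^{(n)},\mathcal{T},\mathcal{T}]$. $\mathcal{T}_n$ is the affine variety (structure constants in a fixed basis of $\mathbb{V}=\mathbb{F}^n$) of nilpotent Lie triple system structures on $\mathbb{V}$, with $\mathrm{GL}(\mathbb{V})$ acting by $(g*\mu)(x,y,z)=g\mu(g^{-1}x,g^{-1}y,g^{-1}z)$; $O(\mu)$ is the orbit, closures are Zariski closures; rigid means the orbit is open. $\mathcal{T}_{3,2}$ has basis $e_1,e_2,e_3$ with only nonzero products $[e_1,e_2,e_1]=e_3=-[e_2,e_1,e_1]$. *)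

theory Defs
  imports Main "HOL-Library.Numeral_Type" "HOL-Library.Extended_Nat"
    "HOL-Computational_Algebra.Polynomial"
begin

definition alg_closed :: "'a::field itself \<Rightarrow> bool" where
  "alg_closed _ \<longleftrightarrow> (\<forall>p :: 'a poly. degree p \<ge> 1 \<longrightarrow> (\<exists>x. poly p x = 0))"

section \<open>Zariski topology on affine space F^I (points are functions I => F, I finite)\<close>

inductive_set zpoly_fun :: "(('i \<Rightarrow> 'a::comm_ring_1) \<Rightarrow> 'a) set" where
  zconst: "(\<lambda>_. c) \<in> zpoly_fun"
| zvar: "(\<lambda>x. x i) \<in> zpoly_fun"
| zadd: "p \<in> zpoly_fun \<Longrightarrow> q \<in> zpoly_fun \<Longrightarrow> (\<lambda>x. p x + q x) \<in> zpoly_fun"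
| zmult: "p \<in> zpoly_fun \<Longrightarrow> q \<in> zpoly_fun \<Longrightarrow> (\<lambda>x. p x * q x) \<in> zpoly_fun"

definition zariski_closed :: "('i \<Rightarrow> 'a::comm_ring_1) set \<Rightarrow> bool" where
  "zariski_closed C \<longleftrightarrow> (\<exists>P \<subseteq> zpoly_fun. C = {x. \<forall>p\<in>P. p x = 0})"

definition zariski_closure :: "('i \<Rightarrow> 'a::comm_ring_1) set \<Rightarrow> ('i \<Rightarrow> 'a) set" where
  "zariski_closure S = \<Inter>{C. zariski_closed C \<and> S \<subseteq> C}"

definition rel_closed :: "('i \<Rightarrow> 'a::comm_ring_1) set \<Rightarrow> ('i \<Rightarrow> 'a) set \<Rightarrow> bool" where
  "rel_closed S Z \<longleftrightarrow> (\<exists>C. zariski_closed C \<and> Z = S \<inter> C)"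

definition rel_open :: "('i \<Rightarrow> 'a::comm_ring_1) set \<Rightarrow> ('i \<Rightarrow> 'a) set \<Rightarrow> bool" where
  "rel_open S U \<longleftrightarrow> (\<exists>C. zariski_closed C \<and> U = S - C)"

definition zariski_irreducible :: "('i \<Rightarrow> 'a::comm_ring_1) set \<Rightarrow> bool" where
  "zariski_irreducible Z \<longleftrightarrow> Z \<noteq> {} \<and>
     (\<forall>C1 C2. zariski_closed C1 \<and> zariski_closed C2 \<and> Z \<subseteq> C1 \<union> C2 \<longrightarrow> Z \<subseteq> C1 \<or> Z \<subseteq> C2)"

definition irr_chain :: "('i \<Rightarrow> 'a::comm_ring_1) set \<Rightarrow> nat \<Rightarrow> bool" where
  "irr_chain S k \<longleftrightarrow> (\<exists>Z :: nat \<Rightarrow> ('i \<Rightarrow> 'a) set.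
      (\<forall>i\<le>k. zariski_irreducible (Z i) \<and> rel_closed S (Z i)) \<and>
      (\<forall>i<k. Z i \<subset> Z (Suc i)))"

definition zariski_dim :: "('i \<Rightarrow> 'a::comm_ring_1) set \<Rightarrow> enat" where
  "zariski_dim S = Sup {enat k | k. irr_chain S k}"

text \<open>A structure is given by structure constants mu(i,j,k,l) = coefficient of e_l in [e_i,e_j,e_k].\<close>
type_synonym 'a struct3 = "3 \<times> 3 \<times> 3 \<times> 3 \<Rightarrow> 'a"

definition brk :: "'a::comm_ring_1 struct3 \<Rightarrow> (3 \<Rightarrow> 'a) \<Rightarrow> (3 \<Rightarrow> 'a) \<Rightarrow> (3 \<Rightarrow> 'a) \<Rightarrow> (3 \<Rightarrow> 'a)" where
  "brk \<mu> x y z = (\<lambda>l. \<Sum>i\<in>UNIV. \<Sum>j\<in>UNIV. \<Sum>k\<in>UNIV. x i * y j * z k * \<mu> (i, j, k, l))"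

definition is_lts :: "'a::comm_ring_1 struct3 \<Rightarrow> bool" where
  "is_lts \<mu> \<longleftrightarrow>
     (\<forall>x y z l. brk \<mu> x y z l + brk \<mu> y x z l = 0) \<and>
     (\<forall>x y z l. brk \<mu> x y z l + brk \<mu> y z x l + brk \<mu> z x y l = 0) \<and>
     (\<forall>u v x y z l. brk \<mu> u v (brk \<mu> x y z) l =
         brk \<mu> (brk \<mu> u v x) y z l + brk \<mu> x (brk \<mu> u v y) z l + brk \<mu> x y (brk \<mu> u v z) l)"

inductive_set lspan :: "('k \<Rightarrow> 'a::comm_ring_1) set \<Rightarrow> ('k \<Rightarrow> 'a) set" for S where
  span_zero: "(\<lambda>_. 0) \<in> lspan S"
| span_gen: "x \<in> S \<Longrightarrow> x \<in> lspan S"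
| span_add: "x \<in> lspan S \<Longrightarrow> y \<in> lspan S \<Longrightarrow> (\<lambda>i. x i + y i) \<in> lspan S"
| span_smult: "x \<in> lspan S \<Longrightarrow> (\<lambda>i. c * x i) \<in> lspan S"

primrec derived :: "'a::comm_ring_1 struct3 \<Rightarrow> nat \<Rightarrow> (3 \<Rightarrow> 'a) set" where
  "derived \<mu> 0 = UNIV"
| "derived \<mu> (Suc n) = lspan {brk \<mu> a b c | a b c. a \<in> derived \<mu> n}"

definition nilpotent_lts :: "'a::comm_ring_1 struct3 \<Rightarrow> bool" where
  "nilpotent_lts \<mu> \<longleftrightarrow> (\<exists>m. derived \<mu> m = {\<lambda>_. 0})"

definition T3 :: "'a::comm_ring_1 struct3 set" where
  "T3 = {\<mu>. is_lts \<mu> \<and> nilpotent_lts \<mu>}"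

definition mv :: "(3 \<Rightarrow> 3 \<Rightarrow> 'a::comm_ring_1) \<Rightarrow> (3 \<Rightarrow> 'a) \<Rightarrow> (3 \<Rightarrow> 'a)" where
  "mv A x = (\<lambda>i. \<Sum>j\<in>UNIV. A i j * x j)"

definition orbit :: "'a::comm_ring_1 struct3 \<Rightarrow> 'a struct3 set" where
  "orbit \<mu> = {\<nu>. \<exists>g h. (\<forall>x. mv g (mv h x) = x) \<and> (\<forall>x. mv h (mv g x) = x) \<and>
      (\<forall>x y z. brk \<nu> x y z = mv g (brk \<mu> (mv h x) (mv h y) (mv h z)))}"

definition rigid :: "'a::comm_ring_1 struct3 \<Rightarrow> bool" where
  "rigid \<mu> \<longleftrightarrow> rel_open T3 (orbit \<mu>)"

text \<open>T_{3,2}: basis e1,e2,e3 = indices 0,1,2; [e1,e2,e1] = e3 = -[e2,e1,e1].\<close>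
definition T32 :: "'a::comm_ring_1 struct3" where
  "T32 = (\<lambda>(i, j, k, l).
      if (i, j, k, l) = (0, 1, 0, 2) then 1
      else if (i, j, k, l) = (1, 0, 0, 2) then -1 else 0)"

end

theory Submission
  imports Defs
begin

text \<open>A nonzero central vector \<open>z\<close> exists by nilpotency; antisymmetry then forces
  \<open>[x, y, w] = det(z, x, y) L(w)\<close>, and nilpotency once more forces \<open>L(w) = \<phi>(w) z\<close> with
  \<open>\<phi>(z) = 0\<close>. Writing \<open>\<phi>\<close> as a cross product with \<open>z\<close> exhibits the variety as a polynomial
  image of an affine 6-space, hence irreducible, and its nonzero points form one orbit.

  For the upper bound on the dimension, a chain of \<open>k + 1\<close> irreducible closed subsets yields
  \<open>k\<close> algebraically independent polynomial functions on the largest one, whereas any five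
  polynomial functions become dependent on a dense chart parametrised by an affine 4-space.
  The lower bound comes from closures of images of coordinate subspaces of that chart.\<close>

section \<open>Polynomial functions and the Zariski topology\<close>

text \<open>The number 4 is a parameter count: pairs \<open>z\<close>, \<open>\<phi>\<close> with
  \<open>dot z \<phi> = 0\<close> have 5 degrees of freedom, and since \<open>z\<close> enters the
  bracket twice, replacing \<open>z\<close> by \<open>c z\<close> has the same effect as replacing
  \<open>\<phi>\<close> by \<open>c^2 \<phi>\<close>. Two parametrisations are used: the 6-space is
  redundant but reaches every system, while the chart has the right number of parameters but misses
  the nonzero systems whose central vector has third coordinate 0. Characteristic different from 2
  turns antisymmetry into alternation, from which the determinant arises. Algebraic closedness
  supplies an infinite field, over which nonzero polynomial functions have a nonzero
  product.\<close>

lemma infinite_UNIV_of_alg_closed: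
  assumes "alg_closed TYPE('a::field)"
  shows "infinite (UNIV :: 'a set)"
proof
  assume fin: "finite (UNIV :: 'a set)"
  \<comment> \<open>Over a finite field \<open>q\<close> vanishes everywhere, so
    \<open>q + 1\<close> has no root.\<close>
  define q :: "'a poly" where "q = (\<Prod>a\<in>UNIV. [:-a, 1:])"
  have "degree q = (\<Sum>a\<in>(UNIV::'a set). 1)"
    unfolding q_def by (subst degree_prod_eq_sum_degree) auto
  hence "degree q \<ge> 1"
    using fin by (simp add: Suc_le_eq card_gt_0_iff)
  moreover have "degree (q + 1) = degree q"
    by (rule degree_add_eq_left) (use calculation in simp)
  ultimately obtain x where "poly (q + 1) x = 0"
    using assms unfolding alg_closed_def by metis
  moreover have "poly q x = 0"
    unfolding q_def using fin by (auto simp: poly_prod prod_zero_iff)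
  ultimately show False by simp
qed

lemma zpoly_fun_uminus: "p \<in> zpoly_fun \<Longrightarrow> (\<lambda>x. - p x) \<in> zpoly_fun"
  using zmult[OF zconst[of "-1"], of p] by simp

lemma zpoly_fun_diff:
  "p \<in> zpoly_fun \<Longrightarrow> q \<in> zpoly_fun \<Longrightarrow> (\<lambda>x. p x - q x) \<in> zpoly_fun"
  using zadd[OF _ zpoly_fun_uminus, of p q] by simp

lemma zpoly_fun_sum:
  "(\<And>a. a \<in> A \<Longrightarrow> p a \<in> zpoly_fun) \<Longrightarrow> (\<lambda>x. \<Sum>a\<in>A. p a x) \<in> zpoly_fun"
  by (induction A rule: infinite_finite_induct) (auto intro: zconst zadd)

lemma zpoly_fun_power: "p \<in> zpoly_fun \<Longrightarrow> (\<lambda>x. p x ^ n) \<in> zpoly_fun"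
  by (induction n) (auto intro: zconst zmult)

lemmas zpoly_fun_intros =
  zconst zvar zadd zmult zpoly_fun_uminus zpoly_fun_diff zpoly_fun_sum zpoly_fun_power

lemma zpoly_fun_comp:
  assumes "p \<in> zpoly_fun" and "\<And>i. (\<lambda>s. \<Phi> s i) \<in> zpoly_fun"
  shows "(\<lambda>s. p (\<Phi> s)) \<in> zpoly_fun"
  using assms(1) by induction (auto intro: zpoly_fun_intros assms(2))

lemma zpoly_fun_on_line:
  assumes "p \<in> zpoly_fun"
  shows "\<exists>P. \<forall>t. p (\<lambda>i. x i + t * (y i - x i)) = poly P t"
  using assms
proof induction
  case (zconst c)
  show ?case by (rule exI[of _ "[:c:]"]) simp
next
  case (zvar i)
  show ?case by (rule exI[of _ "[:x i, y i - x i:]"]) (simp add: algebra_simps)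
next
  case (zadd p q)
  then obtain P Q where "\<forall>t. p (\<lambda>i. x i + t * (y i - x i)) = poly P t"
    "\<forall>t. q (\<lambda>i. x i + t * (y i - x i)) = poly Q t" by blast
  then show ?case by (intro exI[of _ "P + Q"]) simp
next
  case (zmult p q)
  then obtain P Q where "\<forall>t. p (\<lambda>i. x i + t * (y i - x i)) = poly P t"
    "\<forall>t. q (\<lambda>i. x i + t * (y i - x i)) = poly Q t" by blast
  then show ?case by (intro exI[of _ "P * Q"]) simp
qed

text \<open>Restricting to the line through a nonzero of \<open>p\<close> and a nonzero of \<open>q\<close> reduces the
  claim to univariate polynomials.\<close>

lemma zpoly_fun_mult_eq_0:
  fixes p q :: "('i \<Rightarrow> 'a::field) \<Rightarrow> 'a"
  assumes inf: "infinite (UNIV :: 'a set)"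
    and p: "p \<in> zpoly_fun" and q: "q \<in> zpoly_fun"
    and zero: "\<And>x. p x * q x = 0" and py: "p x \<noteq> 0"
  shows "q y = 0"
proof (rule ccontr)
  assume qy: "q y \<noteq> 0"
  obtain P where P: "\<And>t. p (\<lambda>i. x i + t * (y i - x i)) = poly P t"
    using zpoly_fun_on_line[OF p] by blast
  obtain Q where Q: "\<And>t. q (\<lambda>i. x i + t * (y i - x i)) = poly Q t"
    using zpoly_fun_on_line[OF q] by blast
  have "P \<noteq> 0" using P[of 0] py by auto
  moreover have "Q \<noteq> 0" using Q[of 1] qy by auto
  ultimately have "finite {t. poly (P * Q) t = 0}"
    using poly_roots_finite[of "P * Q"] by simp
  moreover have "{t. poly (P * Q) t = 0} = UNIV"
    using zero by (auto simp flip: P Q)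
  ultimately have "finite (UNIV :: 'a set)" by (simp only:)
  with inf show False by contradiction
qed

lemma zariski_closed_Collect:
  "P \<subseteq> zpoly_fun \<Longrightarrow> zariski_closed {x. \<forall>p\<in>P. p x = 0}"
  unfolding zariski_closed_def by blast

lemma zariski_closed_zeros: "p \<in> zpoly_fun \<Longrightarrow> zariski_closed {x. p x = 0}"
  using zariski_closed_Collect[of "{p}"] by simp

lemma zariski_closed_Un:
  fixes C D :: "('i \<Rightarrow> 'a::idom) set"
  assumes "zariski_closed C" "zariski_closed D"
  shows "zariski_closed (C \<union> D)"
proof -
  obtain P where P: "P \<subseteq> zpoly_fun" "C = {x. \<forall>p\<in>P. p x = 0}"
    using assms(1) unfolding zariski_closed_def by blast
  obtain Q where Q: "Q \<subseteq> zpoly_fun" "D = {x. \<forall>p\<in>Q. p x = 0}"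
    using assms(2) unfolding zariski_closed_def by blast
  define R where "R = (\<lambda>(p, q) x. p x * q x) ` (P \<times> Q)"
  have "R \<subseteq> zpoly_fun"
    using P(1) Q(1) unfolding R_def by (auto intro!: zmult)
  moreover have "C \<union> D = {x. \<forall>r\<in>R. r x = 0}"
    unfolding P(2) Q(2) R_def by (simp add: set_eq_iff)
  ultimately show ?thesis unfolding zariski_closed_def by blast
qed

lemma zariski_closed_zero: "zariski_closed {\<lambda>_. 0 :: 'a::comm_ring_1}"
proof -
  have "{\<lambda>_. 0} = {x :: 'i \<Rightarrow> 'a. \<forall>p\<in>range (\<lambda>i x. x i). p x = 0}"
    by (simp add: set_eq_iff fun_eq_iff)
  moreover have "range (\<lambda>i (x :: 'i \<Rightarrow> 'a). x i) \<subseteq> zpoly_fun" by (auto intro: zvar)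
  ultimately show ?thesis unfolding zariski_closed_def by blast
qed

lemma zariski_closed_separates:
  assumes "zariski_closed C" "x \<notin> C"
  obtains p where "p \<in> zpoly_fun" "\<And>y. y \<in> C \<Longrightarrow> p y = 0" "p x \<noteq> 0"
  using assms unfolding zariski_closed_def by blast

text \<open>The intersection equals the zero set of all polynomial functions vanishing on
  \<open>S\<close>, because any closed set avoiding a point is separated from it by one such
  function.\<close>

lemma zariski_closed_closure: "zariski_closed (zariski_closure S)"
proof -
  let ?P = "{p \<in> zpoly_fun. \<forall>x\<in>S. p x = 0}"
  have "zariski_closure S = {x. \<forall>p\<in>?P. p x = 0}"
  proof
    show "zariski_closure S \<subseteq> {x. \<forall>p\<in>?P. p x = 0}"
      unfolding zariski_closure_def using zariski_closed_Collect[of ?P] by auto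
    show "{x. \<forall>p\<in>?P. p x = 0} \<subseteq> zariski_closure S"
    proof
      fix x assume x: "x \<in> {x. \<forall>p\<in>?P. p x = 0}"
      have "x \<in> C" if "zariski_closed C" "S \<subseteq> C" for C
      proof (rule ccontr)
        assume "x \<notin> C"
        with that(1) obtain p where "p \<in> zpoly_fun" "\<And>y. y \<in> C \<Longrightarrow> p y = 0" "p x \<noteq> 0"
          by (rule zariski_closed_separates) blast
        with x that(2) show False by (simp add: subset_iff)
      qed
      then show "x \<in> zariski_closure S" unfolding zariski_closure_def by blast
    qed
  qed
  then show ?thesis using zariski_closed_Collect[of ?P] by auto
qed

lemma zariski_closure_subset: "S \<subseteq> zariski_closure S"
  unfolding zariski_closure_def by blast

lemma zariski_closure_minimal: "zariski_closed C \<Longrightarrow> S \<subseteq> C \<Longrightarrow> zariski_closure S \<subseteq> C"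
  unfolding zariski_closure_def by blast

lemma zariski_irreducible_closure:
  assumes "zariski_irreducible S"
  shows "zariski_irreducible (zariski_closure S)"
  unfolding zariski_irreducible_def
proof (intro conjI allI impI)
  show "zariski_closure S \<noteq> {}"
    using assms zariski_closure_subset[of S] unfolding zariski_irreducible_def by blast
next
  fix C D assume CD: "zariski_closed C \<and> zariski_closed D \<and> zariski_closure S \<subseteq> C \<union> D"
  then have "S \<subseteq> C \<or> S \<subseteq> D"
    using assms zariski_closure_subset[of S] unfolding zariski_irreducible_def by blast
  then show "zariski_closure S \<subseteq> C \<or> zariski_closure S \<subseteq> D"
    using CD zariski_closure_minimal by blast
qed

text \<open>A cover of \<open>S - B\<close> by \<open>C\<close> and \<open>D\<close> extends to a
  cover of \<open>S\<close> by \<open>C\<close> and \<open>D \<union> B\<close>. This serves to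
  remove the zero system, which the orbit lacks.\<close>

lemma zariski_irreducible_Diff:
  fixes S :: "('i \<Rightarrow> 'a::idom) set"
  assumes "zariski_irreducible S" "zariski_closed B" "\<not> S \<subseteq> B"
  shows "zariski_irreducible (S - B)"
  unfolding zariski_irreducible_def
proof (intro conjI allI impI)
  show "S - B \<noteq> {}" using assms(3) by blast
next
  fix C D assume CD: "zariski_closed C \<and> zariski_closed D \<and> S - B \<subseteq> C \<union> D"
  then have "zariski_closed (D \<union> B)" "S \<subseteq> C \<union> (D \<union> B)"
    using zariski_closed_Un assms(2) by blast+
  then consider "S \<subseteq> C" | "S \<subseteq> D \<union> B"
    using assms(1) CD unfolding zariski_irreducible_def by blast
  then show "S - B \<subseteq> C \<or> S - B \<subseteq> D" by cases auto
qed

lemma zariski_irreducible_zeros: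
  assumes "zariski_irreducible Z" "f \<in> zpoly_fun" "g \<in> zpoly_fun"
    and "\<And>x. x \<in> Z \<Longrightarrow> f x * g x = (0 :: 'a::idom)" and "x \<in> Z" "f x \<noteq> 0" and "y \<in> Z"
  shows "g y = 0"
proof -
  have "Z \<subseteq> {x. f x = 0} \<union> {x. g x = 0}" using assms(4) by auto
  then have "Z \<subseteq> {x. f x = 0} \<or> Z \<subseteq> {x. g x = 0}"
    using assms(1-3) zariski_closed_zeros unfolding zariski_irreducible_def by metis
  then show ?thesis using assms(5-7) by blast
qed

text \<open>If neither closed set contained the image, two separating functions pulled back along
  \<open>\<Phi>\<close> would be nonzero with product zero. Only one line in the parameter space
  matters, so \<open>'j\<close> may be infinite, such as \<open>nat\<close>.\<close>

lemma zariski_irreducible_range: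
  fixes \<Phi> :: "('j \<Rightarrow> 'a::field) \<Rightarrow> 'i \<Rightarrow> 'a"
  assumes inf: "infinite (UNIV :: 'a set)" and \<Phi>: "\<And>i. (\<lambda>s. \<Phi> s i) \<in> zpoly_fun"
  shows "zariski_irreducible (range \<Phi>)"
  unfolding zariski_irreducible_def
proof (intro conjI allI impI)
  fix C D assume CD: "zariski_closed C \<and> zariski_closed D \<and> range \<Phi> \<subseteq> C \<union> D"
  show "range \<Phi> \<subseteq> C \<or> range \<Phi> \<subseteq> D"
  proof (rule ccontr)
    assume "\<not> (range \<Phi> \<subseteq> C \<or> range \<Phi> \<subseteq> D)"
    then obtain s t where st: "\<Phi> s \<notin> C" "\<Phi> t \<notin> D" by blast
    obtain p where p: "p \<in> zpoly_fun" "\<And>y. y \<in> C \<Longrightarrow> p y = 0" "p (\<Phi> s) \<noteq> 0"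
      using CD st(1) by (auto elim: zariski_closed_separates)
    obtain q where q: "q \<in> zpoly_fun" "\<And>y. y \<in> D \<Longrightarrow> q y = 0" "q (\<Phi> t) \<noteq> 0"
      using CD st(2) by (auto elim: zariski_closed_separates)
    have "p (\<Phi> r) * q (\<Phi> r) = 0" for r
      using p(2)[of "\<Phi> r"] q(2)[of "\<Phi> r"] CD by auto
    then show False
      using zpoly_fun_mult_eq_0[where p = "\<lambda>s. p (\<Phi> s)" and q = "\<lambda>s. q (\<Phi> s)" and x = s and y = t]
        inf zpoly_fun_comp[OF p(1), of \<Phi>] zpoly_fun_comp[OF q(1), of \<Phi>] \<Phi> p(3) q(3)
      by simp
  qed
qed blast

section \<open>Algebraic independence on a set\<close>

text \<open>The shorter list decides where the product stops. \<open>alg_indep_on\<close> therefore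
  fixes the length of exponent lists; otherwise one monomial would have several names.\<close>

fun monom_fun :: "('x \<Rightarrow> 'a::comm_ring_1) list \<Rightarrow> nat list \<Rightarrow> 'x \<Rightarrow> 'a" where
  "monom_fun (f # fs) (a # as) x = f x ^ a * monom_fun fs as x"
| "monom_fun _ _ x = 1"

definition alg_indep_on :: "'x set \<Rightarrow> ('x \<Rightarrow> 'a::comm_ring_1) list \<Rightarrow> bool" where
  "alg_indep_on Z fs \<longleftrightarrow> (\<forall>A c. finite A \<longrightarrow> A \<subseteq> {as. length as = length fs} \<longrightarrow>
     (\<forall>x\<in>Z. (\<Sum>as\<in>A. c as * monom_fun fs as x) = 0) \<longrightarrow> (\<forall>as\<in>A. c as = 0))"

lemma alg_indep_on_mono: "alg_indep_on Z fs \<Longrightarrow> Z \<subseteq> Z' \<Longrightarrow> alg_indep_on Z' fs"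
  unfolding alg_indep_on_def by (meson subsetD)

lemma alg_indep_on_Nil: "Z \<noteq> {} \<Longrightarrow> alg_indep_on Z []"
proof -
  assume "Z \<noteq> {}"
  then obtain x where x: "x \<in> Z" by blast
  show ?thesis
    unfolding alg_indep_on_def
  proof (intro allI impI ballI)
    fix A :: "nat list set" and c as
    assume "A \<subseteq> {as. length as = length []}" "as \<in> A"
      and rel: "\<forall>x\<in>Z. (\<Sum>as\<in>A. c as * monom_fun [] as x) = 0"
    then have "A = {[]}" "as = []" by auto
    with rel x show "c as = 0" by auto
  qed
qed

lemma zpoly_fun_monom_fun: "set fs \<subseteq> zpoly_fun \<Longrightarrow> (\<lambda>x. monom_fun fs as x) \<in> zpoly_fun"
proof (induction fs arbitrary: as)
  case Nil
  then show ?case by (simp add: zconst)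
next
  case (Cons f fs)
  show ?case
  proof (cases as)
    case Nil
    then show ?thesis by (simp add: zconst)
  next
    case (Cons b bs)
    then show ?thesis
      using Cons.prems Cons.IH[of bs] by (auto intro!: zmult zpoly_fun_power)
  qed
qed

text \<open>Given a nontrivial relation between \<open>f # fs\<close> on \<open>Z'\<close>, divide it by the largest possible
  power of \<open>f\<close>; on \<open>Z\<close>, where \<open>f = 0\<close>, the quotient becomes a nontrivial relation between \<open>fs\<close>.\<close>

lemma alg_indep_on_Cons:
  fixes f :: "('i \<Rightarrow> 'a::idom) \<Rightarrow> 'a"
  assumes indep: "alg_indep_on Z fs" and fs: "set fs \<subseteq> zpoly_fun" and f: "f \<in> zpoly_fun"
    and Z': "zariski_irreducible Z'" "Z \<subseteq> Z'"
    and fZ: "\<And>x. x \<in> Z \<Longrightarrow> f x = 0" and fy: "y \<in> Z'" "f y \<noteq> 0"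
  shows "alg_indep_on Z' (f # fs)"
proof (rule ccontr)
  assume "\<not> alg_indep_on Z' (f # fs)"
  then obtain A c where A: "finite A" "A \<subseteq> {as. length as = length (f # fs)}"
    and rel: "\<And>x. x \<in> Z' \<Longrightarrow> (\<Sum>as\<in>A. c as * monom_fun (f # fs) as x) = 0"
    and nz: "\<exists>as\<in>A. c as \<noteq> 0"
    unfolding alg_indep_on_def by blast
  \<comment> \<open>Zero coefficients are dropped so that the least exponent \<open>m\<close> of
    \<open>f\<close> belongs to a term that really occurs.\<close>
  define B where "B = {as \<in> A. c as \<noteq> 0}"
  have B: "finite B" "B \<noteq> {}" using A(1) nz by (auto simp: B_def)
  define m where "m = Min (hd ` B)"
  have m_le: "m \<le> hd as" if "as \<in> B" for as
    unfolding m_def using B(1) that by simp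
  have split_as: "as = hd as # tl as" "length (tl as) = length fs" if "as \<in> B" for as
    using that A(2) by (cases as; force simp: B_def)+
  have "m \<in> hd ` B" unfolding m_def using B by simp
  then obtain as0 where as0: "as0 \<in> B" "hd as0 = m" by blast
  define g where "g = (\<lambda>x. \<Sum>as\<in>B. c as * (f x ^ (hd as - m) * monom_fun fs (tl as) x))"
  have g: "g \<in> zpoly_fun"
    unfolding g_def
    by (rule zpoly_fun_sum, rule zmult[OF zconst], rule zmult, rule zpoly_fun_power[OF f],
        rule zpoly_fun_monom_fun[OF fs])
  have "f x ^ m * g x = 0" if "x \<in> Z'" for x
  proof -
    have "f x ^ m * g x = (\<Sum>as\<in>B. c as * monom_fun (f # fs) as x)"
      unfolding g_def sum_distrib_left
    proof (rule sum.cong)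
      fix as assume as: "as \<in> B"
      have "monom_fun (f # fs) as x = f x ^ hd as * monom_fun fs (tl as) x"
        by (subst split_as(1)[OF as]) simp
      moreover have "f x ^ hd as = f x ^ m * f x ^ (hd as - m)"
        using m_le[OF as] by (simp flip: power_add)
      ultimately show "f x ^ m * (c as * (f x ^ (hd as - m) * monom_fun fs (tl as) x)) =
          c as * monom_fun (f # fs) as x" by (simp add: mult_ac)
    qed simp
    also have "\<dots> = (\<Sum>as\<in>A. c as * monom_fun (f # fs) as x)"
      by (rule sum.mono_neutral_left) (auto simp: B_def A(1))
    finally show ?thesis using rel[OF that] by simp
  qed
  \<comment> \<open>The factor \<open>f x ^ m\<close> can be cancelled on the irreducible
    \<open>Z'\<close>, as \<open>f y\<close> is nonzero.\<close>
  from zariski_irreducible_zeros[OF Z'(1) zpoly_fun_power[OF f] g this fy(1)] fy(2)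
  have gZ': "g x = 0" if "x \<in> Z'" for x using that by simp
  define C where "C = tl ` {as \<in> B. hd as = m}"
  have inj: "inj_on tl {as \<in> B. hd as = m}"
    by (rule inj_onI) (metis (mono_tags, lifting) mem_Collect_eq split_as(1))
  have "(\<Sum>bs\<in>C. c (m # bs) * monom_fun fs bs x) = 0" if x: "x \<in> Z" for x
  proof -
    have "0 = g x" using gZ' x Z'(2) by auto
    \<comment> \<open>On \<open>Z\<close> every power of \<open>f\<close> vanishes except
      \<open>0 ^ 0 = 1\<close>, which leaves the terms with exponent exactly
      \<open>m\<close>.\<close>
    also have "g x = (\<Sum>as\<in>{as \<in> B. hd as = m}. c as * (f x ^ (hd as - m) * monom_fun fs (tl as) x))"
      unfolding g_def using m_le
      by (intro sum.mono_neutral_right) (auto simp: B(1) fZ[OF x] power_0_left le_antisym)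
    also have "\<dots> = (\<Sum>as\<in>{as \<in> B. hd as = m}. c (m # tl as) * monom_fun fs (tl as) x)"
    proof (rule sum.cong)
      fix as assume as: "as \<in> {as \<in> B. hd as = m}"
      then have "m # tl as = as" using split_as(1)[of as] by simp
      then show "c as * (f x ^ (hd as - m) * monom_fun fs (tl as) x) =
          c (m # tl as) * monom_fun fs (tl as) x" using as by simp
    qed simp
    also have "\<dots> = (\<Sum>bs\<in>C. c (m # bs) * monom_fun fs bs x)"
      unfolding C_def by (subst sum.reindex[OF inj]) simp
    finally show ?thesis by simp
  qed
  moreover have "finite C" "C \<subseteq> {as. length as = length fs}"
    using B(1) split_as(2) by (auto simp: C_def)
  ultimately have "c (m # bs) = 0" if "bs \<in> C" for bs
    using indep that unfolding alg_indep_on_def by (elim allE[of _ C] allE[of _ "\<lambda>bs. c (m # bs)"]) auto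
  moreover have "tl as0 \<in> C" using as0 by (auto simp: C_def)
  moreover have "c (m # tl as0) \<noteq> 0" using as0 split_as(1)[OF as0(1)] by (simp add: B_def)
  ultimately show False by blast
qed

text \<open>Each strict inclusion yields a function vanishing on \<open>Z i\<close> but not on
  \<open>Z (Suc i)\<close>, and prepending it preserves independence. The induction starts with the
  empty list on the nonempty \<open>Z 0\<close>.\<close>

lemma irr_chain_imp_alg_indep_on:
  fixes S :: "('i \<Rightarrow> 'a::idom) set"
  assumes "irr_chain S k"
  shows "\<exists>fs. length fs = k \<and> set fs \<subseteq> zpoly_fun \<and> alg_indep_on S fs"
proof -
  obtain Z where Z: "\<And>i. i \<le> k \<Longrightarrow> zariski_irreducible (Z i)" "\<And>i. i \<le> k \<Longrightarrow> rel_closed S (Z i)"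
    "\<And>i. i < k \<Longrightarrow> Z i \<subset> Z (Suc i)"
    using assms unfolding irr_chain_def by blast
  have "\<exists>fs. length fs = i \<and> set fs \<subseteq> zpoly_fun \<and> alg_indep_on (Z i) fs" if "i \<le> k" for i
    using that
  proof (induction i)
    case 0
    then show ?case
      using Z(1)[of 0] alg_indep_on_Nil[of "Z 0"] unfolding zariski_irreducible_def by simp
  next
    case (Suc i)
    then obtain fs where fs: "length fs = i" "set fs \<subseteq> zpoly_fun" "alg_indep_on (Z i) fs" by auto
    obtain C where C: "zariski_closed C" "Z i = S \<inter> C"
      using Z(2)[of i] Suc.prems unfolding rel_closed_def by auto
    obtain y where y: "y \<in> Z (Suc i)" "y \<notin> Z i" using Z(3)[of i] Suc.prems by auto
    \<comment> \<open>Closedness is relative to \<open>S\<close>; as \<open>y\<close> lies in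
      \<open>S\<close>, being outside \<open>Z i\<close> puts it outside \<open>C\<close>.\<close>
    have "y \<notin> C" using y C(2) Z(2)[OF Suc.prems] unfolding rel_closed_def by blast
    then obtain f where f: "f \<in> zpoly_fun" "\<And>x. x \<in> C \<Longrightarrow> f x = 0" "f y \<noteq> 0"
      using C(1) by (auto elim: zariski_closed_separates)
    have "alg_indep_on (Z (Suc i)) (f # fs)"
      using Z(1)[OF Suc.prems] Z(3)[of i] Suc.prems fs f y C(2)
      by (intro alg_indep_on_Cons[of "Z i"]) auto
    then show ?case using fs f(1) by (intro exI[of _ "f # fs"]) auto
  qed
  then obtain fs where "length fs = k" "set fs \<subseteq> zpoly_fun" "alg_indep_on (Z k) fs" by blast
  moreover have "Z k \<subseteq> S" using Z(2)[of k] unfolding rel_closed_def by auto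
  ultimately show ?thesis using alg_indep_on_mono by blast
qed

section \<open>Counting monomials with bounded exponents\<close>

lemma exists_linear_relation:
  fixes v :: "'b \<Rightarrow> 'c \<Rightarrow> 'a::field"
  assumes "finite B" "finite A" "card B < card A"
  shows "\<exists>c. (\<exists>a\<in>A. c a \<noteq> 0) \<and> (\<forall>b\<in>B. (\<Sum>a\<in>A. c a * v a b) = 0)"
  using assms
proof (induction B arbitrary: A v rule: finite_induct)
  case empty
  then have "A \<noteq> {}" by auto
  then show ?case by (intro exI[of _ "\<lambda>_. 1"]) auto
next
  case (insert b B)
  show ?case
  proof (cases "\<forall>a\<in>A. v a b = 0")
    case True
    obtain c where "\<exists>a\<in>A. c a \<noteq> 0" "\<forall>b\<in>B. (\<Sum>a\<in>A. c a * v a b) = 0"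
      using insert.IH[of A v] insert.prems insert.hyps by auto
    then show ?thesis using True by (intro exI[of _ c]) auto
  next
    case False
    then obtain a0 where a0: "a0 \<in> A" "v a0 b \<noteq> 0" by blast
    define A' where "A' = A - {a0}"
    \<comment> \<open>Elimination with pivot \<open>v a0 b\<close>: subtracting multiples of row
      \<open>a0\<close> clears column \<open>b\<close>.\<close>
    define w where "w = (\<lambda>a b'. v a b' - v a b / v a0 b * v a0 b')"
    have "finite A'" "card B < card A'"
      using insert.prems insert.hyps a0 by (auto simp: A'_def)
    then obtain c where c: "\<exists>a\<in>A'. c a \<noteq> 0" "\<forall>b\<in>B. (\<Sum>a\<in>A'. c a * w a b) = 0"
      using insert.IH[of A' w] by auto
    \<comment> \<open>\<open>- s\<close> is the value that equation \<open>b\<close> forces on the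
      unknown of \<open>a0\<close>.\<close>
    define s where "s = (\<Sum>a\<in>A'. c a * (v a b / v a0 b))"
    define c' where "c' = c(a0 := - s)"
    have sum: "(\<Sum>a\<in>A. c' a * v a b') = (\<Sum>a\<in>A'. c a * w a b')" for b'
    proof -
      have "(\<Sum>a\<in>A. c' a * v a b') = - s * v a0 b' + (\<Sum>a\<in>A'. c' a * v a b')"
        using a0 insert.prems(1) by (subst sum.remove[of A a0]) (auto simp: c'_def A'_def)
      also have "(\<Sum>a\<in>A'. c' a * v a b') = (\<Sum>a\<in>A'. c a * v a b')"
        by (rule sum.cong) (auto simp: c'_def A'_def)
      also have "- s * v a0 b' + \<dots> = (\<Sum>a\<in>A'. c a * w a b')"
        unfolding s_def w_def by (simp add: sum_distrib_left sum_distrib_right sum_subtractf algebra_simps)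
      finally show ?thesis .
    qed
    have "w a b = 0" for a using a0(2) by (simp add: w_def)
    then have "\<forall>b'\<in>insert b B. (\<Sum>a\<in>A. c' a * v a b') = 0"
      unfolding sum using c(2) by simp
    moreover have "\<exists>a\<in>A. c' a \<noteq> 0" using c(1) by (auto simp: c'_def A'_def)
    ultimately show ?thesis by blast
  qed
qed

lemma lspan_mono: "x \<in> lspan S \<Longrightarrow> S \<subseteq> T \<Longrightarrow> x \<in> lspan T"
  by (induction rule: lspan.induct) (auto intro: lspan.intros)

lemma lspan_image_coeffs:
  assumes "f \<in> lspan (m ` B)" "finite B"
  shows "\<exists>c. f = (\<lambda>x. \<Sum>b\<in>B. c b * m b x)"
  using assms(1)
proof induction
  case span_zero
  show ?case by (rule exI[of _ "\<lambda>_. 0"]) simp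
next
  case (span_gen x)
  then obtain b where "b \<in> B" "x = m b" by blast
  have "(\<Sum>b'\<in>B. (if b' = b then 1 else 0) * m b' y) = (\<Sum>b'\<in>B. if b' = b then m b y else 0)" for y
    by (rule sum.cong) auto
  then have "x = (\<lambda>y. \<Sum>b'\<in>B. (if b' = b then 1 else 0) * m b' y)"
    using \<open>b \<in> B\<close> \<open>x = m b\<close> assms(2) by simp
  then show ?case by (rule exI[of _ "\<lambda>b'. if b' = b then 1 else 0"])
next
  case (span_add x y)
  then obtain c d where "x = (\<lambda>x. \<Sum>b\<in>B. c b * m b x)" "y = (\<lambda>x. \<Sum>b\<in>B. d b * m b x)" by blast
  then show ?case
    by (intro exI[of _ "\<lambda>b. c b + d b"]) (simp add: sum.distrib distrib_right)
next
  case (span_smult x k)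
  then obtain c where "x = (\<lambda>x. \<Sum>b\<in>B. c b * m b x)" by blast
  then show ?case
    by (intro exI[of _ "\<lambda>b. k * c b"]) (simp add: sum_distrib_left mult.assoc)
qed

text \<open>Each exponent is bounded separately, not the total degree, which makes the cardinality a
  plain power.\<close>

definition exponents :: "nat \<Rightarrow> nat \<Rightarrow> nat list set" where
  "exponents n D = {as. set as \<subseteq> {..D} \<and> length as = n}"

lemma finite_exponents: "finite (exponents n D)"
  unfolding exponents_def by (rule finite_lists_length_eq) simp

lemma card_exponents: "card (exponents n D) = Suc D ^ n"
  unfolding exponents_def by (subst card_lists_length_eq) simp_all

lemma exponents_mono: "D \<le> E \<Longrightarrow> exponents n D \<subseteq> exponents n E"
  unfolding exponents_def by auto

definition poly_span :: "('x \<Rightarrow> 'a::comm_ring_1) list \<Rightarrow> nat \<Rightarrow> ('x \<Rightarrow> 'a) set" where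
  "poly_span X D = lspan (monom_fun X ` exponents (length X) D)"

lemma poly_span_mono: "f \<in> poly_span X D \<Longrightarrow> D \<le> E \<Longrightarrow> f \<in> poly_span X E"
  unfolding poly_span_def by (erule lspan_mono) (use exponents_mono in blast)

lemma monom_fun_mult:
  "length as = length X \<Longrightarrow> length bs = length X \<Longrightarrow>
   monom_fun X as x * monom_fun X bs x = monom_fun X (map2 (+) as bs) x"
proof (induction X arbitrary: as bs)
  case (Cons f X)
  then obtain a as' b bs' where "as = a # as'" "bs = b # bs'"
    by (metis length_Suc_conv)
  moreover from this have "monom_fun X (map2 (+) as' bs') x = monom_fun X as' x * monom_fun X bs' x"
    using Cons by simp
  ultimately show ?case by (simp add: power_add mult_ac)
qed simp

lemma map2_plus_exponents:
  "as \<in> exponents n D \<Longrightarrow> bs \<in> exponents n E \<Longrightarrow> map2 (+) as bs \<in> exponents n (D + E)"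
  unfolding exponents_def by (auto dest!: set_zip_leftD set_zip_rightD intro!: add_mono elim!: in_set_zipE)

lemma monom_fun_in_poly_span:
  "as \<in> exponents (length X) D \<Longrightarrow> (\<lambda>x. monom_fun X as x) \<in> poly_span X D"
  unfolding poly_span_def by (intro span_gen) auto

lemma poly_span_mult:
  assumes "f \<in> poly_span X D" "g \<in> poly_span X E"
  shows "(\<lambda>x. f x * g x) \<in> poly_span X (D + E)"
  using assms(1) unfolding poly_span_def[of X D]
proof (induction rule: lspan.induct)
  case span_zero
  show ?case unfolding poly_span_def by (simp add: lspan.span_zero)
next
  case (span_gen f)
  then obtain as where as: "as \<in> exponents (length X) D" "f = monom_fun X as" by blast
  show ?case
    using assms(2) unfolding poly_span_def[of X E]
  proof (induction rule: lspan.induct)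
    case span_zero
    show ?case unfolding poly_span_def by (simp add: lspan.span_zero)
  next
    case (span_gen g)
    then obtain bs where bs: "bs \<in> exponents (length X) E" "g = monom_fun X bs" by blast
    have "(\<lambda>x. f x * g x) = (\<lambda>x. monom_fun X (map2 (+) as bs) x)"
      using as bs by (auto simp: monom_fun_mult exponents_def)
    then show ?case
      using monom_fun_in_poly_span[OF map2_plus_exponents[OF as(1) bs(1)]] by simp
  next
    case (span_add g h)
    from lspan.span_add[OF this(3,4)[unfolded poly_span_def]]
    show ?case unfolding poly_span_def by (simp add: distrib_left)
  next
    case (span_smult g c)
    from lspan.span_smult[OF this(2)[unfolded poly_span_def], of c]
    show ?case unfolding poly_span_def by (simp add: mult_ac)
  qed
next
  case (span_add g h)
  from lspan.span_add[OF this(3,4)[unfolded poly_span_def]]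
  show ?case unfolding poly_span_def by (simp add: distrib_right)
next
  case (span_smult g c)
  from lspan.span_smult[OF this(2)[unfolded poly_span_def], of c]
  show ?case unfolding poly_span_def by (simp add: mult_ac)
qed

lemma monom_fun_zeros: "monom_fun X (replicate n 0) x = 1"
proof (induction X arbitrary: n)
  case (Cons f X)
  then show ?case by (cases n) simp_all
qed simp

lemma poly_span_const: "(\<lambda>_. c) \<in> poly_span X D"
proof -
  have "(\<lambda>x. c * monom_fun X (replicate (length X) 0) x) = (\<lambda>_. c)"
    by (simp add: monom_fun_zeros)
  moreover have "(\<lambda>x. c * monom_fun X (replicate (length X) 0) x) \<in> poly_span X D"
    unfolding poly_span_def
    by (intro lspan.span_smult lspan.span_gen imageI) (auto simp: exponents_def)
  ultimately show ?thesis by simp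
qed

lemma poly_span_add:
  assumes "f \<in> poly_span X D" "g \<in> poly_span X E"
  shows "(\<lambda>x. f x + g x) \<in> poly_span X (D + E)"
  using poly_span_mono[OF assms(1), of "D + E"] poly_span_mono[OF assms(2), of "D + E"]
  unfolding poly_span_def by (simp add: lspan.span_add)

lemma poly_span_power: "f \<in> poly_span X D \<Longrightarrow> (\<lambda>x. f x ^ k) \<in> poly_span X (k * D)"
proof (induction k)
  case (Suc k)
  then show ?case using poly_span_mult[of f X D "\<lambda>x. f x ^ k" "k * D"] by simp
qed (simp add: poly_span_const)

lemma poly_span_nth:
  assumes "j < length X"
  shows "X ! j \<in> poly_span X 1"
proof -
  let ?as = "map (\<lambda>i. if i = j then 1 else 0) [0..<length X]"
  have "monom_fun X (map (\<lambda>i. if i = j then 1 else 0) [0..<length X]) x = (X ! j) x" for x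
    using assms
  proof (induction X arbitrary: j)
    case (Cons f X)
    have "map (\<lambda>i. if i = j then 1 else 0) [0..<length (f # X)] =
      (if j = 0 then 1 else 0) # map (\<lambda>i. if Suc i = j then 1 else (0::nat)) [0..<length X]"
      by (simp add: upt_conv_Cons map_Suc_upt[symmetric] del: upt_Suc)
    then show ?case
      using Cons by (cases j) (simp_all add: map_replicate_const monom_fun_zeros)
  qed simp
  then have "(\<lambda>x. monom_fun X ?as x) = X ! j" by auto
  moreover have "?as \<in> exponents (length X) 1" by (auto simp: exponents_def)
  ultimately show ?thesis using monom_fun_in_poly_span by metis
qed

text \<open>Members of \<open>zpoly_fun\<close> carry no degree; induction on their construction
  finds some bound along \<open>\<Psi>\<close> in terms of the finite list \<open>X\<close>.\<close>

lemma poly_span_comp: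
  assumes "p \<in> zpoly_fun" and "\<And>i. \<exists>D. (\<lambda>t. \<Psi> t i) \<in> poly_span X D"
  shows "\<exists>D. (\<lambda>t. p (\<Psi> t)) \<in> poly_span X D"
  using assms(1)
proof induction
  case (zadd p q)
  then show ?case using poly_span_add by blast
next
  case (zmult p q)
  then show ?case using poly_span_mult by blast
qed (use assms(2) poly_span_const in blast)+

lemma poly_span_monom_fun:
  assumes "set fs \<subseteq> poly_span X D" "set as \<subseteq> {..M}"
  shows "(\<lambda>x. monom_fun fs as x) \<in> poly_span X (length fs * (M * D))"
  using assms
proof (induction fs arbitrary: as)
  case (Cons f fs)
  show ?case
  proof (cases as)
    case (Cons a as')
    have "(\<lambda>x. f x ^ a) \<in> poly_span X (M * D)"
      using Cons Cons.prems by (intro poly_span_mono[OF poly_span_power[of f X D]]) auto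
    moreover have "(\<lambda>x. monom_fun fs as' x) \<in> poly_span X (length fs * (M * D))"
      using Cons Cons.prems by (intro Cons.IH) auto
    ultimately show ?thesis using poly_span_mult Cons by fastforce
  qed (simp add: poly_span_const)
next
  case Nil
  have "(\<lambda>x. monom_fun [] as x) = (\<lambda>_. 1)" by simp
  then show ?case using poly_span_const[of 1 X 0] by simp
qed

text \<open>There are \<open>(M + 1) ^ k\<close> monomials in \<open>k\<close> functions with exponents at most \<open>M\<close>, and they
  lie in a space of dimension at most \<open>(k * M * D + 1) ^ n\<close>.\<close>

lemma not_alg_indep_on_poly_span:
  fixes fs X :: "('x \<Rightarrow> 'a::field) list"
  assumes fs: "set fs \<subseteq> poly_span X D" and len: "length X < length fs"
  shows "\<not> alg_indep_on UNIV fs"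
proof
  assume indep: "alg_indep_on UNIV fs"
  define n where "n = length X"
  define k where "k = length fs"
  \<comment> \<open>With this \<open>M\<close>, \<open>Suc E \<le> Suc M * (k * D + 1)\<close> gives
    \<open>Suc E ^ n \<le> Suc M ^ n * M\<close>, just below \<open>Suc M ^ Suc n\<close>.\<close>
  define M where "M = (k * D + 1) ^ n"
  define E where "E = k * (M * D)"
  have "Suc E ^ n \<le> (Suc M * (k * D + 1)) ^ n"
    by (rule power_mono) (simp_all add: E_def algebra_simps)
  also have "\<dots> = Suc M ^ n * M" by (simp only: M_def power_mult_distrib)
  also have "\<dots> < Suc M ^ n * Suc M" by simp
  also have "\<dots> = Suc M ^ Suc n" by simp
  also have "\<dots> \<le> Suc M ^ k" using len by (intro power_increasing) (auto simp: n_def k_def)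
  finally have card: "card (exponents n E) < card (exponents k M)"
    by (simp only: card_exponents)
  have "\<exists>c. (\<lambda>x. monom_fun fs as x) = (\<lambda>x. \<Sum>bs\<in>exponents n E. c bs * monom_fun X bs x)"
    if "as \<in> exponents k M" for as
    using poly_span_monom_fun[OF fs, of as M] that
    unfolding poly_span_def E_def k_def n_def
    by (intro lspan_image_coeffs finite_exponents) (auto simp: exponents_def)
  then obtain v where v: "\<And>as x. as \<in> exponents k M \<Longrightarrow>
      monom_fun fs as x = (\<Sum>bs\<in>exponents n E. v as bs * monom_fun X bs x)"
    by (metis (no_types))
  \<comment> \<open>\<open>v\<close> has more rows than columns; a dependence between its rows is an
    algebraic relation between \<open>fs\<close>.\<close>
  obtain c where c: "\<exists>as\<in>exponents k M. c as \<noteq> 0"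
    "\<forall>bs\<in>exponents n E. (\<Sum>as\<in>exponents k M. c as * v as bs) = 0"
    using exists_linear_relation[OF finite_exponents finite_exponents card, of v] by blast
  have "(\<Sum>as\<in>exponents k M. c as * monom_fun fs as x) = 0" for x
  proof -
    have "(\<Sum>as\<in>exponents k M. c as * monom_fun fs as x)
        = (\<Sum>as\<in>exponents k M. \<Sum>bs\<in>exponents n E. c as * v as bs * monom_fun X bs x)"
      by (simp add: v sum_distrib_left mult.assoc)
    also have "\<dots> = (\<Sum>bs\<in>exponents n E. (\<Sum>as\<in>exponents k M. c as * v as bs) * monom_fun X bs x)"
      by (subst sum.swap) (simp add: sum_distrib_right)
    finally show ?thesis using c(2) by simp
  qed
  moreover have "exponents k M \<subseteq> {as. length as = length fs}"
    by (auto simp: exponents_def k_def)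
  ultimately show False
    using indep c(1) finite_exponents unfolding alg_indep_on_def by blast
qed

section \<open>Nilpotent Lie triple systems on the three-dimensional space\<close>

lemma exhaust_3': "i = 0 \<or> i = 1 \<or> i = (2::3)"
proof (induct i)
  case (of_int z)
  then have "z = 0 \<or> z = 1 \<or> z = 2" by auto
  then show ?case by auto
qed

lemma UNIV_3': "UNIV = {0, 1, 2::3}"
  using exhaust_3' by auto

lemma sum_3': "(\<Sum>i\<in>UNIV. f i) = f 0 + f 1 + f (2::3)"
  unfolding UNIV_3' by (simp add: add.assoc)

lemma all_3': "(\<forall>i. P i) \<longleftrightarrow> P 0 \<and> P 1 \<and> P (2::3)"
  using exhaust_3' by metis

lemma numerals_mod_3 [simp]: "(3::3) = 0" "(4::3) = 1"
  by simp_all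

section \<open>Vector algebra in dimension three\<close>

definition dot :: "(3 \<Rightarrow> 'a::comm_ring_1) \<Rightarrow> (3 \<Rightarrow> 'a) \<Rightarrow> 'a" where
  "dot x y = (\<Sum>i\<in>UNIV. x i * y i)"

text \<open>The indices are added modulo 3.\<close>

definition cross :: "(3 \<Rightarrow> 'a::comm_ring_1) \<Rightarrow> (3 \<Rightarrow> 'a) \<Rightarrow> 3 \<Rightarrow> 'a" where
  "cross x y = (\<lambda>i. x (i + 1) * y (i + 2) - x (i + 2) * y (i + 1))"

definition axis :: "3 \<Rightarrow> 3 \<Rightarrow> 'a::comm_ring_1" where
  "axis i = (\<lambda>j. if j = i then 1 else 0)"

lemma dot_expand: "dot x y = x 0 * y 0 + x 1 * y 1 + x 2 * y 2"
  by (simp add: dot_def sum_3')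

lemma cross_nth [simp]:
  "cross x y 0 = x 1 * y 2 - x 2 * y 1"
  "cross x y 1 = x 2 * y 0 - x 0 * y 2"
  "cross x y 2 = x 0 * y 1 - x 1 * y 0"
  by (simp_all add: cross_def)

lemma axis_nth [simp]:
  "axis 0 0 = 1" "axis 0 1 = 0" "axis 0 2 = 0"
  "axis 1 0 = 0" "axis 1 1 = 1" "axis 1 2 = 0"
  "axis 2 0 = 0" "axis 2 1 = 0" "axis 2 2 = 1"
  by (simp_all add: axis_def)

lemma fun_eq_3: "x = y \<longleftrightarrow> x 0 = y 0 \<and> x 1 = y 1 \<and> x (2::3) = y 2"
  by (simp add: fun_eq_iff all_3')

lemma nonzero_3: "x \<noteq> (\<lambda>_. 0) \<Longrightarrow> x 0 \<noteq> 0 \<or> x 1 \<noteq> 0 \<or> x (2::3) \<noteq> 0"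
  by (simp add: fun_eq_3)

lemma cross_eq_zero_imp_parallel:
  fixes z u :: "3 \<Rightarrow> 'a::field"
  assumes "cross z u = (\<lambda>_. 0)" "z \<noteq> (\<lambda>_. 0)"
  obtains a where "u = (\<lambda>i. a * z i)"
proof -
  have eqs: "z 1 * u 2 = z 2 * u 1" "z 2 * u 0 = z 0 * u 2" "z 0 * u 1 = z 1 * u 0"
    using assms(1) by (simp_all add: fun_eq_3)
  consider "z 0 \<noteq> 0" | "z 1 \<noteq> 0" | "z 2 \<noteq> 0" using nonzero_3[OF assms(2)] by blast
  then show ?thesis
  proof cases
    case 1
    show ?thesis
      by (rule that[of "u 0 / z 0"]) (use 1 eqs in \<open>simp add: fun_eq_3 field_simps\<close>)
  next
    case 2
    show ?thesis
      by (rule that[of "u 1 / z 1"]) (use 2 eqs in \<open>simp add: fun_eq_3 field_simps\<close>)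
  next
    case 3
    show ?thesis
      by (rule that[of "u 2 / z 2"]) (use 3 eqs in \<open>simp add: fun_eq_3 field_simps\<close>)
  qed
qed

text \<open>Over a general field \<open>dot z z\<close> may vanish, so one cannot divide by it.
  Instead \<open>w\<close> gets coordinate 0 at a place where \<open>z\<close> is nonzero, and its
  other coordinates are solved for.\<close>

lemma orthogonal_imp_cross:
  fixes z u :: "3 \<Rightarrow> 'a::field"
  assumes "dot z u = 0" "z \<noteq> (\<lambda>_. 0)"
  obtains w where "u = cross z w"
proof -
  have eq: "z 0 * u 0 + z 1 * u 1 + z 2 * u 2 = 0" using assms(1) by (simp add: dot_expand)
  note intro = that
  have w: thesis if "u 0 = z 1 * c - z 2 * b" "u 1 = z 2 * a - z 0 * c" "u 2 = z 0 * b - z 1 * a" for a b c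
    by (rule intro[of "\<lambda>i. if i = 0 then a else if i = 1 then b else c"]) (simp add: fun_eq_3 that)
  consider "z 0 \<noteq> 0" | "z 1 \<noteq> 0" | "z 2 \<noteq> 0" using nonzero_3[OF assms(2)] by blast
  then show ?thesis
  proof cases
    case 1
    have "z 0 * u 0 = - (z 1 * u 1) - z 2 * u 2"
      using eq by (simp add: algebra_simps eq_neg_iff_add_eq_0)
    then have "u 0 = z 1 * (- u 1 / z 0) - z 2 * (u 2 / z 0)"
      using 1 by (simp add: divide_simps mult.commute)
    then show ?thesis using 1 by (intro w[where a = 0 and b = "u 2 / z 0" and c = "- u 1 / z 0"]) simp_all
  next
    case 2
    have "z 1 * u 1 = - (z 2 * u 2) - z 0 * u 0"
      using eq by (simp add: algebra_simps eq_neg_iff_add_eq_0)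
    then have "u 1 = z 2 * (- u 2 / z 1) - z 0 * (u 0 / z 1)"
      using 2 by (simp add: divide_simps mult.commute)
    then show ?thesis using 2 by (intro w[where a = "- u 2 / z 1" and b = 0 and c = "u 0 / z 1"]) simp_all
  next
    case 3
    have "z 2 * u 2 = - (z 0 * u 0) - z 1 * u 1"
      using eq by (simp add: algebra_simps eq_neg_iff_add_eq_0)
    then have "u 2 = z 0 * (- u 0 / z 2) - z 1 * (u 1 / z 2)"
      using 3 by (simp add: divide_simps mult.commute)
    then show ?thesis using 3 by (intro w[where a = "u 1 / z 2" and b = "- u 0 / z 2" and c = 0]) simp_all
  qed
qed

section \<open>The normal form of a nilpotent system\<close>

lemma brk_axis: "brk \<mu> (axis i) (axis j) (axis k) l = \<mu> (i, j, k, l)"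
  using exhaust_3'[of i] exhaust_3'[of j] exhaust_3'[of k]
  by (elim disjE) (simp_all add: brk_def sum_3')

lemma struct3_eqI: "(\<And>x y z. brk \<mu> x y z = brk \<nu> x y z) \<Longrightarrow> \<mu> = \<nu>"
  by (rule ext) (metis brk_axis surj_pair)

text \<open>Here \<open>dot z (cross x y)\<close> is the determinant of \<open>z\<close>,
  \<open>x\<close>, \<open>y\<close>: the bracket is a decomposable tensor made of an alternating
  form with radical \<open>z\<close>, the form \<open>\<phi>\<close> and the vector \<open>z\<close>
  (for nonzero \<open>z\<close>).\<close>

definition rank1_lts :: "(3 \<Rightarrow> 'a::comm_ring_1) \<Rightarrow> (3 \<Rightarrow> 'a) \<Rightarrow> 'a struct3" where
  "rank1_lts z \<phi> = (\<lambda>(i, j, k, l). dot z (cross (axis i) (axis j)) * \<phi> k * z l)"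

lemma brk_factor:
  assumes "\<And>i j k l. \<mu> (i, j, k, l) = dot z (cross (axis i) (axis j)) * A k l"
  shows "brk \<mu> x y w l = dot z (cross x y) * (\<Sum>k\<in>UNIV. w k * A k l)"
  unfolding brk_def assms by (simp add: sum_3' dot_expand) (simp add: algebra_simps)

lemma brk_rank1_lts:
  "brk (rank1_lts z \<phi>) x y w l = dot z (cross x y) * dot \<phi> w * z l"
  by (subst brk_factor[where A = "\<lambda>k l. \<phi> k * z l" and z = z])
    (simp_all add: rank1_lts_def dot_expand sum_3' algebra_simps)

lemma brk_axis_expand_left: "brk \<mu> x y w l = (\<Sum>i\<in>UNIV. x i * brk \<mu> (axis i) y w l)"
  unfolding brk_def by (simp add: sum_3' axis_def algebra_simps)

text \<open>This is Cramer's rule, expressing \<open>dot x (cross y w)\<close> times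
  \<open>z\<close> through \<open>x\<close>, \<open>y\<close>, \<open>w\<close>, after application
  of \<open>\<phi>\<close>. It reduces (A2) to \<open>dot \<phi> z = 0\<close>.\<close>

lemma dot_cross_identity:
  "dot z (cross x y) * dot \<phi> w + dot z (cross y w) * dot \<phi> x + dot z (cross w x) * dot \<phi> y
    = dot x (cross y w) * dot \<phi> z"
  by (simp add: dot_expand algebra_simps)

text \<open>Linearity in the first slot carries the vanishing from products to their span. This
  replaces nilpotency, which is existential in \<open>m\<close>, by polynomial equations.\<close>

lemma derived_2_eq_zero:
  assumes "\<And>x y w u v. brk \<mu> (brk \<mu> x y w) u v = (\<lambda>_. 0)"
  shows "derived \<mu> 2 = {\<lambda>_. 0}"
proof -
  have add: "brk \<mu> (\<lambda>i. a i + b i) u v = (\<lambda>l. brk \<mu> a u v l + brk \<mu> b u v l)" for a b u v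
    by (simp add: brk_def fun_eq_iff distrib_right sum.distrib)
  have smult: "brk \<mu> (\<lambda>i. c * a i) u v = (\<lambda>l. c * brk \<mu> a u v l)" for c a u v
    by (simp add: brk_def fun_eq_iff sum_distrib_left mult.assoc)
  have brk_zero: "brk \<mu> a u v = (\<lambda>_. 0)" if "a \<in> derived \<mu> 1" for a u v
  proof -
    from that have "a \<in> lspan {brk \<mu> a b c | a b c. a \<in> UNIV}" by simp
    then show ?thesis
      by induction (auto simp: assms add smult, simp add: brk_def)
  qed
  have "x = (\<lambda>_. 0)" if "x \<in> derived \<mu> 2" for x
  proof -
    from that have "x \<in> lspan {brk \<mu> a b c | a b c. a \<in> derived \<mu> 1}"
      by (simp add: numeral_2_eq_2)
    then show ?thesis by induction (auto simp: brk_zero simp del: derived.simps)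
  qed
  then show ?thesis by (auto simp: numeral_2_eq_2 lspan.span_zero)
qed

lemma T3_I:
  assumes "is_lts \<mu>" "\<And>x y w u v. brk \<mu> (brk \<mu> x y w) u v = (\<lambda>_. 0)"
  shows "\<mu> \<in> T3"
  using assms(1) derived_2_eq_zero[OF assms(2)] unfolding T3_def nilpotent_lts_def by blast

lemma brk_brk_rank1_lts: "brk (rank1_lts z \<phi>) (brk (rank1_lts z \<phi>) x y w) u v = (\<lambda>_. 0)"
proof -
  have "dot z (cross (brk (rank1_lts z \<phi>) x y w) u) = 0"
    by (simp add: brk_rank1_lts dot_expand) (simp add: algebra_simps)
  then show ?thesis by (simp add: fun_eq_iff brk_rank1_lts)
qed

text \<open>(A1) is the antisymmetry of the determinant and (A2) is Cramer's rule. In (A3) all terms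
  vanish: products are multiples of \<open>z\<close>, and \<open>z\<close> in any slot gives
  zero.\<close>

lemma rank1_lts_in_T3:
  assumes "dot \<phi> z = 0"
  shows "rank1_lts z \<phi> \<in> T3"
proof (rule T3_I)
  have a1: "brk (rank1_lts z \<phi>) x y w l + brk (rank1_lts z \<phi>) y x w l = 0" for x y w l
    by (simp add: brk_rank1_lts dot_expand algebra_simps)
  have a2: "brk (rank1_lts z \<phi>) x y w l + brk (rank1_lts z \<phi>) y w x l
      + brk (rank1_lts z \<phi>) w x y l = 0" for x y w l
    using arg_cong[OF dot_cross_identity[of z x y \<phi> w], of "\<lambda>t. t * z l"] assms
    by (simp add: brk_rank1_lts algebra_simps)
  have z1: "brk (rank1_lts z \<phi>) u (brk (rank1_lts z \<phi>) x y w) v = (\<lambda>_. 0)" for u v x y w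
  proof -
    have "dot z (cross u (brk (rank1_lts z \<phi>) x y w)) = 0"
      by (simp add: brk_rank1_lts dot_expand) (simp add: algebra_simps)
    then show ?thesis by (simp add: fun_eq_iff brk_rank1_lts)
  qed
  have z2: "brk (rank1_lts z \<phi>) u v (brk (rank1_lts z \<phi>) x y w) = (\<lambda>_. 0)" for u v x y w
  proof -
    have "dot \<phi> (brk (rank1_lts z \<phi>) x y w) = dot z (cross x y) * dot \<phi> w * dot \<phi> z"
      by (simp add: dot_expand[of \<phi> "brk _ _ _ _"] dot_expand[of \<phi> z] brk_rank1_lts algebra_simps)
    then show ?thesis using assms by (simp add: fun_eq_iff brk_rank1_lts)
  qed
  show "is_lts (rank1_lts z \<phi>)"
    unfolding is_lts_def using a1 a2 by (simp add: z1 z2 brk_brk_rank1_lts)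
qed (rule brk_brk_rank1_lts)

lemma zero_in_derived: "(\<lambda>_. 0) \<in> derived \<mu> n"
  by (cases n) (simp_all add: lspan.span_zero)

text \<open>A nonzero element of the last nonzero term of the derived series is central.\<close>

lemma nilpotent_lts_central_element:
  fixes \<mu> :: "'a::field struct3"
  assumes "\<mu> \<in> T3"
  obtains z where "z \<noteq> (\<lambda>_. 0)" "\<And>x y. brk \<mu> z x y = (\<lambda>_. 0)" "\<And>x y. brk \<mu> x z y = (\<lambda>_. 0)"
    "\<And>x y. brk \<mu> x y z = (\<lambda>_. 0)"
proof -
  from assms obtain M where lts: "is_lts \<mu>" and M: "derived \<mu> M = {\<lambda>_. 0}"
    by (auto simp: T3_def nilpotent_lts_def)
  have "(\<lambda>_. 1) \<in> derived \<mu> 0" by simp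
  moreover have "(\<lambda>_. 1) \<noteq> (\<lambda>_. 0 :: 'a)" by (simp add: fun_eq_iff)
  ultimately have "derived \<mu> 0 \<noteq> {\<lambda>_. 0}" by blast
  with ex_least_nat_less[of "\<lambda>m. derived \<mu> m = {\<lambda>_. 0}", OF M]
  obtain m where m: "derived \<mu> m \<noteq> {\<lambda>_. 0}" "derived \<mu> (Suc m) = {\<lambda>_. 0}"
    by (metis order_refl)
  obtain z where z: "z \<in> derived \<mu> m" "z \<noteq> (\<lambda>_. 0)"
    using m(1) zero_in_derived[of \<mu> m] by blast
  have zc: "brk \<mu> z x y = (\<lambda>_. 0)" for x y
  proof -
    have "brk \<mu> z x y \<in> derived \<mu> (Suc m)" using z(1) by (auto intro: lspan.span_gen)
    then show ?thesis using m(2) by blast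
  qed
  \<comment> \<open>(A1) and (A2) carry the vanishing from the first slot to the other two.\<close>
  have cz: "brk \<mu> x z y = (\<lambda>_. 0)" for x y
  proof
    fix l
    have "brk \<mu> x z y l + brk \<mu> z x y l = 0" using lts unfolding is_lts_def by blast
    then show "brk \<mu> x z y l = 0" by (simp add: zc)
  qed
  have "brk \<mu> x y z = (\<lambda>_. 0)" for x y
  proof
    fix l
    have "brk \<mu> x y z l + brk \<mu> y z x l + brk \<mu> z x y l = 0" using lts unfolding is_lts_def by blast
    then show "brk \<mu> x y z l = 0" by (simp add: zc cz)
  qed
  with z(2) zc cz show ?thesis using that by blast
qed

lemma T3_imp_rank1_lts:
  fixes \<mu> :: "'a::field struct3"
  assumes T3: "\<mu> \<in> T3" and two: "(2::'a) \<noteq> 0"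
  obtains z \<phi> where "\<mu> = rank1_lts z \<phi>" "z \<noteq> (\<lambda>_. 0)" "dot z \<phi> = 0"
proof -
  obtain z where z: "z \<noteq> (\<lambda>_. 0)" and zc: "\<And>x y. brk \<mu> z x y = (\<lambda>_. 0)"
    and cz: "\<And>x y. brk \<mu> x y z = (\<lambda>_. 0)"
    using nilpotent_lts_central_element[OF T3] by metis
  have anti: "\<mu> (j, i, k, l) = - \<mu> (i, j, k, l)" for i j k l
  proof -
    have "brk \<mu> (axis i) (axis j) (axis k) l + brk \<mu> (axis j) (axis i) (axis k) l = 0"
      using T3 unfolding T3_def is_lts_def by blast
    then show ?thesis by (simp add: brk_axis eq_neg_iff_add_eq_0 add.commute)
  qed
  \<comment> \<open>This is where characteristic different from 2 enters.\<close>
  have diag: "\<mu> (i, i, k, l) = 0" for i k l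
  proof -
    have "2 * \<mu> (i, i, k, l) = \<mu> (i, i, k, l) + - \<mu> (i, i, k, l)"
      unfolding anti[of i i k l, symmetric] by (rule mult_2)
    then show ?thesis using two by simp
  qed
  \<comment> \<open>For fixed \<open>k\<close> and \<open>l\<close> an alternating form is a vector,
    read off at the cyclic index pairs. That \<open>z\<close> lies in its radical means that this
    vector has zero cross product with \<open>z\<close>.\<close>
  have "\<exists>a. (\<lambda>i. \<mu> (i + 1, i + 2, k, l)) = (\<lambda>i. a * z i)" for k l
  proof -
    have eq: "(\<Sum>i\<in>UNIV. z i * \<mu> (i, j, k, l)) = 0" for j
      using zc[of "axis j" "axis k"] brk_axis_expand_left[of \<mu> z "axis j" "axis k" l]
      by (simp add: brk_axis)
    have "cross z (\<lambda>i. \<mu> (i + 1, i + 2, k, l)) = (\<lambda>_. 0)"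
      using eq[of 0] eq[of 1] eq[of 2] anti[of 0 1] anti[of 0 2] anti[of 1 2]
      by (simp add: sum_3' fun_eq_3 diag neg_eq_iff_add_eq_0)
    then show ?thesis using z by (rule cross_eq_zero_imp_parallel) blast
  qed
  then obtain A where A: "\<And>k l. (\<lambda>i. \<mu> (i + 1, i + 2, k, l)) = (\<lambda>i. A k l * z i)" by metis
  have \<mu>: "\<mu> (i, j, k, l) = dot z (cross (axis i) (axis j)) * A k l" for i j k l
  proof -
    have "\<mu> (1, 2, k, l) = A k l * z 0" "\<mu> (2, 0, k, l) = A k l * z 1" "\<mu> (0, 1, k, l) = A k l * z 2"
      using fun_cong[OF A[of k l], of 0] fun_cong[OF A[of k l], of 1] fun_cong[OF A[of k l], of 2]
      by simp_all
    then show ?thesis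
      using exhaust_3'[of i] exhaust_3'[of j]
      by (elim disjE) (simp_all add: dot_expand diag anti[of 1 0] anti[of 2 1] anti[of 0 2])
  qed
  define L where "L = (\<lambda>w l. \<Sum>k\<in>UNIV. w k * A k l)"
  have brk: "brk \<mu> x y w = (\<lambda>l. dot z (cross x y) * L w l)" for x y w
    unfolding L_def using brk_factor[OF \<mu>] by blast
  have volume: "\<exists>x y. dot z (cross x y) = 1"
    using nonzero_3[OF z]
  proof (elim disjE)
    assume "z 0 \<noteq> 0"
    then show ?thesis
      by (intro exI[of _ "\<lambda>i. axis 1 i / z 0"] exI[of _ "axis 2"]) (simp add: dot_expand)
  next
    assume "z 1 \<noteq> 0"
    then show ?thesis
      by (intro exI[of _ "\<lambda>i. axis 2 i / z 1"] exI[of _ "axis 0"]) (simp add: dot_expand)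
  next
    assume "z 2 \<noteq> 0"
    then show ?thesis
      by (intro exI[of _ "\<lambda>i. axis 0 i / z 2"] exI[of _ "axis 1"]) (simp add: dot_expand)
  qed
  obtain m where m: "derived \<mu> m = {\<lambda>_. 0}"
    using T3 by (auto simp: T3_def nilpotent_lts_def)
  \<comment> \<open>Since \<open>[L w, y, w]\<close> is \<open>dot z (cross (L w) y)\<close> times
    \<open>L w\<close>, a nonzero factor would keep \<open>L w\<close> in every term of the derived
    series.\<close>
  have isotropic: "dot z (cross (L w) y) = 0" for w y
  proof (rule ccontr)
    assume d: "dot z (cross (L w) y) \<noteq> 0"
    have "L w \<in> derived \<mu> n" for n
    proof (induction n)
      case (Suc n)
      have "brk \<mu> (L w) y w \<in> derived \<mu> (Suc n)"
        using Suc by (auto intro: lspan.span_gen)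
      then have "(\<lambda>l. (1 / dot z (cross (L w) y)) * brk \<mu> (L w) y w l) \<in> derived \<mu> (Suc n)"
        unfolding derived.simps by (rule lspan.span_smult)
      then show ?case using d by (simp add: brk)
    qed simp
    then have "L w = (\<lambda>_. 0)" using m by blast
    then show False using d by (simp add: dot_expand)
  qed
  have "\<exists>a. A k = (\<lambda>l. a * z l)" for k
  proof -
    have Lk: "L (axis k) = A k"
      using exhaust_3'[of k] by (auto simp: L_def sum_3' fun_eq_iff)
    have "cross z (A k) = (\<lambda>_. 0)"
      using isotropic[of "axis k" "axis 0"] isotropic[of "axis k" "axis 1"]
        isotropic[of "axis k" "axis 2"]
      unfolding Lk by (simp add: dot_expand fun_eq_3 algebra_simps)
    then show ?thesis using z by (rule cross_eq_zero_imp_parallel) blast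
  qed
  then obtain \<phi> where \<phi>: "\<And>k. A k = (\<lambda>l. \<phi> k * z l)" by metis
  have "\<mu> = rank1_lts z \<phi>"
    by (rule ext) (auto simp: rank1_lts_def \<mu> \<phi> mult.assoc)
  \<comment> \<open>Centrality of \<open>z\<close> in the third slot is evaluated at
    \<open>x\<close>, \<open>y\<close> spanning unit volume with \<open>z\<close>.\<close>
  moreover have "dot z \<phi> = 0"
  proof -
    obtain x y where xy: "dot z (cross x y) = 1" using volume by blast
    obtain l where l: "z l \<noteq> 0" using z by (auto simp: fun_eq_iff)
    have "brk \<mu> x y z l = 0" using cz by simp
    then have "dot z (cross x y) * dot \<phi> z * z l = 0"
      using calculation by (simp add: brk_rank1_lts)
    then show ?thesis using xy l by (simp add: dot_def mult.commute)
  qed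
  ultimately show ?thesis using that z by blast
qed

section \<open>The orbit of the model system\<close>

lemma T32_eq_rank1_lts: "T32 = rank1_lts (axis 2) (axis 0)"
proof
  fix i :: "3 \<times> 3 \<times> 3 \<times> 3"
  obtain a b c d where i: "i = (a, b, c, d)" by (cases i)
  show "T32 i = rank1_lts (axis 2) (axis 0) i"
    using exhaust_3'[of a] exhaust_3'[of b] exhaust_3'[of c] exhaust_3'[of d] unfolding i
    by (elim disjE) (simp_all add: T32_def rank1_lts_def dot_expand)
qed

lemma dot_axis: "dot (axis i) x = x i"
  using exhaust_3'[of i] by (auto simp: dot_expand)

lemma mv_eq_dot: "mv h x i = dot (h i) x"
  by (simp add: mv_def dot_def)

lemma mv_smult: "mv g (\<lambda>i. c * x i) = (\<lambda>i. c * mv g x i)"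
  by (simp add: mv_def fun_eq_iff sum_distrib_left mult_ac)

text \<open>The first two rows of \<open>h\<close> have cross product \<open>\<kappa> z\<close>, where \<open>z\<close> is the image of the
  third basis vector under \<open>g\<close>.\<close>

lemma orbit_T32_subset: "orbit (T32 :: 'a::field struct3) \<subseteq> T3 - {\<lambda>_. 0}"
proof
  fix \<nu> :: "'a struct3"
  assume "\<nu> \<in> orbit T32"
  then obtain g h where gh: "\<And>x. mv g (mv h x) = x" and hg: "\<And>x. mv h (mv g x) = x"
    and \<nu>: "\<And>x y w. brk \<nu> x y w = mv g (brk T32 (mv h x) (mv h y) (mv h w))"
    unfolding orbit_def by blast
  define z where "z = mv g (axis 2)"
  have hz: "dot (h 0) z = 0" "dot (h 1) z = 0"
    using fun_cong[OF hg[of "axis 2"], of 0] fun_cong[OF hg[of "axis 2"], of 1]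
    by (simp_all add: z_def mv_eq_dot)
  have "mv h z 2 = 1" by (simp add: z_def hg)
  then have z: "z \<noteq> (\<lambda>_. 0)" by (auto simp: mv_def)
  have "cross z (cross (h 0) (h 1)) = (\<lambda>i. h 0 i * dot (h 1) z - h 1 i * dot (h 0) z)"
    by (simp add: fun_eq_3 dot_expand algebra_simps)
  then have "cross z (cross (h 0) (h 1)) = (\<lambda>_. 0)" by (simp add: hz)
  then obtain \<kappa> where \<kappa>: "cross (h 0) (h 1) = (\<lambda>i. \<kappa> * z i)"
    using z by (rule cross_eq_zero_imp_parallel)
  have brk: "brk \<nu> x y w = (\<lambda>l. cross (mv h x) (mv h y) 2 * dot (h 0) w * z l)" for x y w
  proof -
    have "brk T32 (mv h x) (mv h y) (mv h w) =
        (\<lambda>l. (cross (mv h x) (mv h y) 2 * dot (h 0) w) * axis 2 l)"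
      by (simp add: fun_eq_iff T32_eq_rank1_lts brk_rank1_lts dot_axis mv_eq_dot)
    then show ?thesis by (simp only: \<nu> mv_smult z_def)
  qed
  \<comment> \<open>The Binet-Cauchy identity for the rows \<open>h 0\<close> and
    \<open>h 1\<close>.\<close>
  have "cross (mv h x) (mv h y) 2 = dot (cross (h 0) (h 1)) (cross x y)" for x y
    by (simp add: mv_eq_dot dot_expand) (simp add: algebra_simps)
  then have "cross (mv h x) (mv h y) 2 = \<kappa> * dot z (cross x y)" for x y
    by (simp add: \<kappa> dot_expand algebra_simps)
  then have "\<nu> = rank1_lts z (\<lambda>i. \<kappa> * h 0 i)"
    by (intro struct3_eqI) (simp add: fun_eq_iff brk brk_rank1_lts dot_expand[of "\<lambda>i. \<kappa> * h 0 i"]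
        dot_expand[of "h 0"] algebra_simps)
  moreover have "dot (\<lambda>i. \<kappa> * h 0 i) z = 0"
    using hz(1) by (simp add: dot_expand mult.assoc flip: distrib_left)
  ultimately have "\<nu> \<in> T3" by (simp add: rank1_lts_in_T3)
  moreover have "\<nu> \<noteq> (\<lambda>_. 0)"
  proof
    assume "\<nu> = (\<lambda>_. 0)"
    then have "brk \<nu> (mv g (axis 0)) (mv g (axis 1)) (mv g (axis 0)) = (\<lambda>_. 0)"
      by (simp add: brk_def)
    moreover have "dot (h 0) (mv g (axis 0)) = 1"
      using fun_cong[OF hg[of "axis 0"], of 0] by (simp add: mv_eq_dot)
    ultimately have "z = (\<lambda>_. 0)" unfolding brk by (simp add: hg)
    with z show False by blast
  qed
  ultimately show "\<nu> \<in> T3 - {\<lambda>_. 0}" by simp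
qed

text \<open>The rows \<open>\<phi>\<close>, \<open>\<psi>\<close>, \<open>\<chi>\<close> of
  \<open>h\<close> satisfy \<open>cross \<phi> \<psi> = z\<close> and
  \<open>dot \<chi> z = 1\<close>, so \<open>h\<close> has determinant 1. Its inverse
  \<open>g\<close> is then the adjugate, whose columns are cross products of these rows.\<close>

lemma rank1_lts_in_orbit:
  fixes z \<phi> :: "3 \<Rightarrow> 'a::field"
  assumes "z \<noteq> (\<lambda>_. 0)" "\<phi> \<noteq> (\<lambda>_. 0)" "dot z \<phi> = 0"
  shows "rank1_lts z \<phi> \<in> orbit T32"
proof -
  have "dot \<phi> z = 0" using assms(3) by (simp add: dot_def mult.commute)
  then obtain \<psi> where \<psi>: "z = cross \<phi> \<psi>" using assms(2) by (rule orthogonal_imp_cross)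
  obtain r where r: "z r \<noteq> 0" using assms(1) by auto
  define \<chi> where "\<chi> = (\<lambda>i. axis r i / z r)"
  have det: "dot \<chi> z = 1"
    using r exhaust_3'[of r] by (auto simp: \<chi>_def dot_expand)
  define h where "h = (\<lambda>i :: 3. if i = 0 then \<phi> else if i = 1 then \<psi> else \<chi>)"
  define g where "g = (\<lambda>i (j :: 3). if j = 0 then cross \<psi> \<chi> i else if j = 1 then cross \<chi> \<phi> i else z i)"
  have h: "h 0 = \<phi>" "h 1 = \<psi>" "h 2 = \<chi>" by (simp_all add: h_def)
  have g: "mv g x = (\<lambda>i. cross \<psi> \<chi> i * x 0 + cross \<chi> \<phi> i * x 1 + z i * x 2)" for x
    by (simp add: g_def mv_def sum_3')
  have "mv g (mv h x) = (\<lambda>i. dot \<chi> z * x i)" for x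
    unfolding g \<psi> by (simp add: fun_eq_3 mv_eq_dot h dot_expand) (simp add: algebra_simps)
  then have "mv g (mv h x) = x" for x by (simp add: det)
  moreover have "mv h (mv g x) = (\<lambda>i. dot \<chi> z * x i)" for x
    unfolding g \<psi> by (simp add: fun_eq_3 mv_eq_dot h dot_expand) (simp add: algebra_simps)
  then have "mv h (mv g x) = x" for x by (simp add: det)
  moreover have "brk (rank1_lts z \<phi>) x y w = mv g (brk T32 (mv h x) (mv h y) (mv h w))" for x y w
  proof -
    have "cross (mv h x) (mv h y) 2 = dot z (cross x y)"
      unfolding \<psi> by (simp add: mv_eq_dot h dot_expand) (simp add: algebra_simps)
    then have "brk T32 (mv h x) (mv h y) (mv h w) = (\<lambda>l. (dot z (cross x y) * dot \<phi> w) * axis 2 l)"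
      by (simp add: fun_eq_iff T32_eq_rank1_lts brk_rank1_lts dot_axis mv_eq_dot h)
    moreover have "mv g (axis 2) = z" by (simp add: g)
    ultimately have "mv g (brk T32 (mv h x) (mv h y) (mv h w)) =
        (\<lambda>l. (dot z (cross x y) * dot \<phi> w) * z l)" by (simp only: mv_smult)
    then show ?thesis by (simp add: brk_rank1_lts fun_eq_iff)
  qed
  ultimately show ?thesis unfolding orbit_def by blast
qed

lemma orbit_T32:
  assumes "(2::'a::field) \<noteq> 0"
  shows "orbit (T32 :: 'a struct3) = T3 - {\<lambda>_. 0}"
proof
  show "T3 - {\<lambda>_. 0} \<subseteq> orbit (T32 :: 'a struct3)"
  proof
    fix \<mu> :: "'a struct3"
    assume \<mu>: "\<mu> \<in> T3 - {\<lambda>_. 0}"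
    then obtain z \<phi> where *: "\<mu> = rank1_lts z \<phi>" "z \<noteq> (\<lambda>_. 0)" "dot z \<phi> = 0"
      using T3_imp_rank1_lts[OF _ assms] by blast
    moreover have "\<phi> \<noteq> (\<lambda>_. 0)"
      using * \<mu> by (auto simp: rank1_lts_def fun_eq_iff)
    ultimately show "\<mu> \<in> orbit T32" using rank1_lts_in_orbit by blast
  qed
qed (rule orbit_T32_subset)

section \<open>The variety of nilpotent Lie triple systems\<close>

lemma zariski_closed_Collect_all:
  assumes "\<And>a. zariski_closed {x. Q a x}"
  shows "zariski_closed {x. \<forall>a. Q a x}"
proof -
  have "\<forall>a. \<exists>P. P \<subseteq> zpoly_fun \<and> {x. Q a x} = {x. \<forall>p\<in>P. p x = 0}"
    using assms unfolding zariski_closed_def by blast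
  then obtain P where P: "\<And>a. P a \<subseteq> zpoly_fun \<and> {x. Q a x} = {x. \<forall>p\<in>P a. p x = 0}"
    unfolding choice_iff by blast
  then have "Q a x \<longleftrightarrow> (\<forall>p\<in>P a. p x = 0)" for a x by blast
  then have "{x. \<forall>a. Q a x} = {x. \<forall>p\<in>\<Union>(range P). p x = 0}" by simp
  moreover have "\<Union>(range P) \<subseteq> zpoly_fun" using P by blast
  ultimately show ?thesis unfolding zariski_closed_def by blast
qed

lemma zariski_closed_Collect_conj:
  assumes "zariski_closed {x. Q x}" "zariski_closed {x. R x}"
  shows "zariski_closed {x. Q x \<and> R x}"
proof -
  have "zariski_closed {x. if b then Q x else R x}" for b
    using assms by (cases b) simp_all
  then have "zariski_closed {x. \<forall>b. if b then Q x else R x}"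
    by (rule zariski_closed_Collect_all)
  then show ?thesis by (simp add: all_bool_eq conj_commute)
qed

lemma zariski_closed_Collect_eq:
  "p \<in> zpoly_fun \<Longrightarrow> q \<in> zpoly_fun \<Longrightarrow> zariski_closed {x. p x = q x}"
  using zariski_closed_zeros[OF zpoly_fun_diff, of p q] by simp

lemma zpoly_fun_brk:
  assumes "\<And>i. (\<lambda>\<mu>. x \<mu> i) \<in> zpoly_fun" "\<And>i. (\<lambda>\<mu>. y \<mu> i) \<in> zpoly_fun"
    "\<And>i. (\<lambda>\<mu>. w \<mu> i) \<in> zpoly_fun"
  shows "(\<lambda>\<mu>. brk \<mu> (x \<mu>) (y \<mu>) (w \<mu>) l) \<in> zpoly_fun"
  unfolding brk_def by (intro zpoly_fun_sum zmult assms zvar)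

text \<open>The normal form bounds the nilpotency length uniformly: all products with a product in
  the first slot vanish.\<close>

lemma zariski_closed_T3:
  assumes "(2::'a::field) \<noteq> 0"
  shows "zariski_closed (T3 :: 'a struct3 set)"
proof -
  have "(T3 :: 'a struct3 set) =
      {\<mu>. is_lts \<mu> \<and> (\<forall>x y w u v l. brk \<mu> (brk \<mu> x y w) u v l = 0)}" (is "_ = ?C")
  proof
    show "T3 \<subseteq> ?C"
    proof
      fix \<mu> :: "'a struct3" assume \<mu>: "\<mu> \<in> T3"
      then obtain z \<phi> where "\<mu> = rank1_lts z \<phi>" using T3_imp_rank1_lts[OF _ assms] by metis
      then show "\<mu> \<in> ?C" using \<mu> brk_brk_rank1_lts[of z \<phi>] by (simp add: T3_def)
    qed
    show "?C \<subseteq> T3" using T3_I by (auto simp: fun_eq_iff)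
  qed
  moreover have "zariski_closed ?C"
    unfolding is_lts_def
    by (intro zariski_closed_Collect_conj zariski_closed_Collect_all zariski_closed_Collect_eq
        zadd zpoly_fun_brk zconst)
  ultimately show ?thesis by simp
qed

section \<open>Two polynomial parametrisations\<close>

definition vec3 :: "'a \<Rightarrow> 'a \<Rightarrow> 'a \<Rightarrow> 3 \<Rightarrow> 'a" where
  "vec3 a b c = (\<lambda>i. if i = 0 then a else if i = 1 then b else c)"

lemma vec3_nth [simp]: "vec3 a b c 0 = a" "vec3 a b c 1 = b" "vec3 a b c 2 = c"
  by (simp_all add: vec3_def)

lemma zpoly_fun_vec3:
  assumes "a \<in> zpoly_fun" "b \<in> zpoly_fun" "c \<in> zpoly_fun"
  shows "(\<lambda>s. vec3 (a s) (b s) (c s) i) \<in> zpoly_fun"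
  using exhaust_3'[of i] assms by auto

lemma zpoly_fun_rank1_lts:
  assumes "\<And>i. (\<lambda>s. z s i) \<in> zpoly_fun" "\<And>i. (\<lambda>s. \<phi> s i) \<in> zpoly_fun"
  shows "(\<lambda>s. rank1_lts (z s) (\<phi> s) i) \<in> zpoly_fun"
proof -
  obtain a b c d where i: "i = (a, b, c, d)" by (cases i)
  show ?thesis
    unfolding i rank1_lts_def prod.case dot_def by (intro zpoly_fun_sum zmult assms zconst)
qed

lemma rank1_lts_smult: "rank1_lts (\<lambda>i. c * z i) \<phi> = rank1_lts z (\<lambda>i. c^2 * \<phi> i)"
  by (rule ext) (auto simp: rank1_lts_def dot_expand power2_eq_square algebra_simps)

lemma dot_cross_self: "dot (cross z w) z = 0"
  by (simp add: dot_expand algebra_simps)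

text \<open>The cross product solves \<open>dot z \<phi> = 0\<close> without constraints on the
  parameters. Only the coordinates 0 to 5 are read.\<close>

definition T3_param :: "(nat \<Rightarrow> 'a::field) \<Rightarrow> 'a struct3" where
  "T3_param s = rank1_lts (vec3 (s 0) (s 1) (s 2))
     (cross (vec3 (s 0) (s 1) (s 2)) (vec3 (s 3) (s 4) (s 5)))"

lemma zpoly_fun_T3_param: "(\<lambda>s. T3_param s i) \<in> zpoly_fun"
  unfolding T3_param_def cross_def
  by (intro zpoly_fun_rank1_lts zpoly_fun_diff zmult zpoly_fun_vec3 zvar)

lemma T3_eq_range_param:
  assumes "(2::'a::field) \<noteq> 0"
  shows "(T3 :: 'a struct3 set) = range T3_param"
proof
  show "range T3_param \<subseteq> (T3 :: 'a struct3 set)"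
    unfolding T3_param_def by (auto intro!: rank1_lts_in_T3 dot_cross_self)
  show "(T3 :: 'a struct3 set) \<subseteq> range T3_param"
  proof
    fix \<mu> :: "'a struct3" assume "\<mu> \<in> T3"
    then obtain z \<phi> where *: "\<mu> = rank1_lts z \<phi>" "z \<noteq> (\<lambda>_. 0)" "dot z \<phi> = 0"
      using T3_imp_rank1_lts[OF _ assms] by blast
    obtain w where w: "\<phi> = cross z w" using *(3,2) by (rule orthogonal_imp_cross)
    have "vec3 (z 0) (z 1) (z 2) = z" "vec3 (w 0) (w 1) (w 2) = w" by (simp_all add: fun_eq_3)
    then have "\<mu> = T3_param (\<lambda>n. [z 0, z 1, z 2, w 0, w 1, w 2] ! n)"
      unfolding *(1) w T3_param_def by (simp add: numeral_eq_Suc)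
    then show "\<mu> \<in> range T3_param" by blast
  qed
qed

text \<open>The chart of systems whose central vector has third coordinate 1; the third coordinate of
  the linear form is determined by the other two.\<close>

definition T3_chart :: "(nat \<Rightarrow> 'a::field) \<Rightarrow> 'a struct3" where
  "T3_chart t = rank1_lts (vec3 (t 2) (t 3) 1) (vec3 (t 0) (t 1) (- (t 2 * t 0 + t 3 * t 1)))"

lemma zpoly_fun_T3_chart: "(\<lambda>t. T3_chart t i) \<in> zpoly_fun"
  unfolding T3_chart_def
  by (intro zpoly_fun_rank1_lts zpoly_fun_vec3 zpoly_fun_uminus zadd zmult zvar zconst)

lemma T3_chart_in_T3: "T3_chart t \<in> T3"
  unfolding T3_chart_def by (rule rank1_lts_in_T3) (simp add: dot_expand algebra_simps)

lemma T3_param_eq_T3_chart: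
  fixes s :: "nat \<Rightarrow> 'a::field"
  assumes "s 2 \<noteq> 0"
  shows "\<exists>t. T3_param s = T3_chart t"
proof -
  define z where "z = vec3 (s 0) (s 1) (s 2)"
  define \<phi> where "\<phi> = cross z (vec3 (s 3) (s 4) (s 5))"
  have orth: "s 0 * \<phi> 0 + s 1 * \<phi> 1 + s 2 * \<phi> 2 = 0"
    using dot_cross_self[of z "vec3 (s 3) (s 4) (s 5)"]
    by (simp add: dot_expand \<phi>_def z_def mult.commute)
  \<comment> \<open>Scaling \<open>z\<close> to third coordinate 1 extracts the factor
    \<open>s 2\<close>, which reappears squared in the linear form.\<close>
  define t where "t = (\<lambda>n. [(s 2)^2 * \<phi> 0, (s 2)^2 * \<phi> 1, s 0 / s 2, s 1 / s 2] ! n)"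
  have t: "t 0 = (s 2)^2 * \<phi> 0" "t 1 = (s 2)^2 * \<phi> 1" "t 2 = s 0 / s 2" "t 3 = s 1 / s 2"
    by (simp_all add: t_def numeral_eq_Suc)
  have "- (t 2 * t 0 + t 3 * t 1) = - (s 2 * (s 0 * \<phi> 0 + s 1 * \<phi> 1))"
    using assms by (simp add: t power2_eq_square distrib_left mult_ac del: One_nat_def)
  also have "s 0 * \<phi> 0 + s 1 * \<phi> 1 = - (s 2 * \<phi> 2)"
    using orth by (simp add: eq_neg_iff_add_eq_0)
  finally have "vec3 (t 0) (t 1) (- (t 2 * t 0 + t 3 * t 1)) = (\<lambda>i. (s 2)^2 * \<phi> i)"
    by (simp add: fun_eq_3 t power2_eq_square mult.assoc del: One_nat_def)
  moreover have "z = (\<lambda>i. s 2 * vec3 (t 2) (t 3) 1 i)"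
    using assms by (simp add: fun_eq_3 z_def t del: One_nat_def)
  ultimately have "rank1_lts z \<phi> = T3_chart t"
    unfolding T3_chart_def using rank1_lts_smult by metis
  then show ?thesis unfolding T3_param_def \<phi>_def z_def by blast
qed

text \<open>Density of the chart: it covers all parameters with \<open>s 2\<close> nonzero, so
  \<open>s 2\<close> times the pulled-back \<open>p\<close> is identically zero, and the factor
  \<open>s 2\<close> cancels.\<close>

lemma zpoly_fun_zero_on_chart_imp_zero_on_T3:
  fixes p :: "'a::field struct3 \<Rightarrow> 'a"
  assumes inf: "infinite (UNIV :: 'a set)" and two: "(2::'a) \<noteq> 0"
    and p: "p \<in> zpoly_fun" and zero: "\<And>t. p (T3_chart t) = 0" and \<mu>: "\<mu> \<in> T3"
  shows "p \<mu> = 0"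
proof -
  obtain s where s: "\<mu> = T3_param s" using \<mu> T3_eq_range_param[OF two] by blast
  have "(s 2 :: 'a) * p (T3_param s) = 0" for s
    using T3_param_eq_T3_chart[of s] zero by (metis mult_eq_0_iff)
  from zpoly_fun_mult_eq_0[OF inf zvar zpoly_fun_comp[OF p zpoly_fun_T3_param] this, of "\<lambda>_. 1" s]
  have "p (T3_param s) = 0" by simp
  then show ?thesis by (simp add: s)
qed

section \<open>Upper and lower bounds for chains in the orbit\<close>

lemma monom_fun_map_comp: "monom_fun (map (\<lambda>f t. f (\<Psi> t)) fs) as t = monom_fun fs as (\<Psi> t)"
  by (induction fs as "\<Psi> t" rule: monom_fun.induct) simp_all

lemma irr_chain_orbit_T32_le:
  assumes inf: "infinite (UNIV :: 'a::field set)" and two: "(2::'a) \<noteq> 0"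
    and chain: "irr_chain (orbit (T32 :: 'a struct3)) k"
  shows "k \<le> 4"
proof (rule ccontr)
  assume k: "\<not> k \<le> 4"
  obtain fs where fs: "length fs = k" "set fs \<subseteq> zpoly_fun" "alg_indep_on (orbit (T32 :: 'a struct3)) fs"
    using irr_chain_imp_alg_indep_on[OF chain] by blast
  have indep: "alg_indep_on (T3 :: 'a struct3 set) fs"
    using fs(3) by (rule alg_indep_on_mono) (use orbit_T32_subset in blast)
  define gs where "gs = map (\<lambda>f (t :: nat \<Rightarrow> 'a). f (T3_chart t)) fs"
  have "alg_indep_on UNIV gs"
    unfolding alg_indep_on_def
  proof (intro allI impI)
    fix A c
    assume A: "finite A" "A \<subseteq> {as. length as = length gs}"
      and rel: "\<forall>t\<in>UNIV. (\<Sum>as\<in>A. c as * monom_fun gs as t) = 0"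
    have zp: "(\<lambda>x. \<Sum>as\<in>A. c as * monom_fun fs as x) \<in> zpoly_fun"
      by (rule zpoly_fun_sum, rule zmult[OF zconst], rule zpoly_fun_monom_fun[OF fs(2)])
    have "(\<Sum>as\<in>A. c as * monom_fun fs as (T3_chart t)) = 0" for t
      using rel unfolding gs_def monom_fun_map_comp by blast
    from zpoly_fun_zero_on_chart_imp_zero_on_T3[OF inf two zp this]
    have "\<forall>x\<in>T3. (\<Sum>as\<in>A. c as * monom_fun fs as x) = 0" by blast
    then show "\<forall>as\<in>A. c as = 0"
      using indep A unfolding alg_indep_on_def gs_def length_map by blast
  qed
  moreover have "\<not> alg_indep_on UNIV gs"
  proof -
    define X where "X = map (\<lambda>n (t :: nat \<Rightarrow> 'a). t n) [0..<4]"
    \<comment> \<open>Parameters are indexed by \<open>nat\<close>, but each coordinate must lie in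
      the span of monomials in the four functions \<open>X\<close>; \<open>T3_chart\<close> reads
      only the first four.\<close>
    define cut where "cut = (\<lambda>(t :: nat \<Rightarrow> 'a) n. if n < 4 then t n else 0)"
    have "\<exists>D. (\<lambda>t. cut t n) \<in> poly_span X D" for n
    proof (cases "n < 4")
      case True
      then have "X ! n = (\<lambda>t. cut t n)" by (simp add: X_def cut_def)
      then show ?thesis using poly_span_nth[of n X] True by (auto simp: X_def)
    next
      case False
      then show ?thesis using poly_span_const by (simp add: cut_def) blast
    qed
    note comp = poly_span_comp[where X = X and \<Psi> = cut, OF _ this]
    have cut: "T3_chart (cut t) = T3_chart t" for t by (simp add: T3_chart_def cut_def)
    have "\<exists>D. (\<lambda>t. f (T3_chart t)) \<in> poly_span X D" if "f \<in> set fs" for f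
      using comp[of "\<lambda>t. f (T3_chart t)"] zpoly_fun_comp[of f T3_chart] that fs(2) zpoly_fun_T3_chart
      unfolding cut by blast
    then obtain D where D: "\<And>f. f \<in> set fs \<Longrightarrow> (\<lambda>t. f (T3_chart t)) \<in> poly_span X (D f)"
      by metis
    have "(\<lambda>t. f (T3_chart t)) \<in> poly_span X (Max (D ` set fs))" if "f \<in> set fs" for f
      using D[OF that] by (rule poly_span_mono) (use that in simp)
    then have "set gs \<subseteq> poly_span X (Max (D ` set fs))" by (auto simp: gs_def)
    then show ?thesis
      by (rule not_alg_indep_on_poly_span) (use k fs(1) in \<open>simp add: X_def gs_def\<close>)
  qed
  ultimately show False by contradiction
qed

text \<open>Coordinate 0 defaults to 1, so that the chain starts with a single nonzero system
  instead of the zero system.\<close>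

definition mask :: "nat \<Rightarrow> (nat \<Rightarrow> 'a::field) \<Rightarrow> nat \<Rightarrow> 'a" where
  "mask k t = (\<lambda>n. if n < k then t n else if n = 0 then 1 else 0)"

lemma mask_Suc_mask: "mask (Suc k) (mask k t) = mask k t"
  by (auto simp: mask_def)

text \<open>Each entry, the first shifted by the default 1, separates one member of the chain from
  the next.\<close>

lemma T3_chart_entries:
  "T3_chart t (0, 1, 0, 2) = t 0" "T3_chart t (0, 1, 1, 2) = t 1"
  "T3_chart t (0, 1, 0, 0) = t 0 * t 2" "T3_chart t (0, 1, 0, 1) = t 0 * t 3"
  by (simp_all add: T3_chart_def rank1_lts_def dot_expand)

lemma irr_chain_orbit_T32:
  assumes inf: "infinite (UNIV :: 'a::field set)" and two: "(2::'a) \<noteq> 0"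
  shows "irr_chain (orbit (T32 :: 'a struct3)) 4"
proof -
  have "(2::'a) * 2 \<noteq> 0" using two by (simp only: mult_eq_0_iff simp_thms)
  then have four: "(4::'a) \<noteq> 0" by simp
  define W where "W = (\<lambda>k. zariski_closure (range (\<lambda>t :: nat \<Rightarrow> 'a. T3_chart (mask k t))))"
  \<comment> \<open>As \<open>W k\<close> lies in \<open>T3\<close>, removing zero leaves its
    intersection with the orbit.\<close>
  define Z where "Z = (\<lambda>k. W k - {\<lambda>_. 0})"
  have in_W: "T3_chart (mask k t) \<in> W k" for k t
    unfolding W_def by (rule subsetD[OF zariski_closure_subset]) (rule rangeI)
  have nonzero: "T3_chart (mask k (\<lambda>_. 2 :: 'a)) \<noteq> (\<lambda>_. 0)" for k
  proof
    assume "T3_chart (mask k (\<lambda>_. 2 :: 'a)) = (\<lambda>_. 0)"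
    then have "T3_chart (mask k (\<lambda>_. 2 :: 'a)) (0, 1, 0, 2) = 0" by (rule fun_cong)
    then show False using two by (simp add: T3_chart_entries mask_def split: if_splits)
  qed
  have W_T3: "W k \<subseteq> T3" for k
    unfolding W_def
    by (rule zariski_closure_minimal) (auto simp: zariski_closed_T3[OF two] T3_chart_in_T3)
  have "zariski_irreducible (Z k)" for k
    unfolding Z_def
  proof (rule zariski_irreducible_Diff)
    have "(\<lambda>t. mask k t n) \<in> zpoly_fun" for n
      unfolding mask_def by (cases "n < k"; cases "n = 0") (simp_all add: zvar zconst)
    then have "(\<lambda>t. T3_chart (mask k t) i) \<in> zpoly_fun" for i
      using zpoly_fun_comp[OF zpoly_fun_T3_chart, of "mask k" i] by blast
    then show "zariski_irreducible (W k)"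
      unfolding W_def by (intro zariski_irreducible_closure zariski_irreducible_range inf)
    show "\<not> W k \<subseteq> {\<lambda>_. 0}" using in_W nonzero by blast
  qed (rule zariski_closed_zero)
  moreover have "rel_closed (orbit T32) (Z k)" for k
    unfolding rel_closed_def orbit_T32[OF two] Z_def
    using W_T3[of k] zariski_closed_closure unfolding W_def by blast
  moreover have "Z k \<subset> Z (Suc k)" if k: "k < 4" for k
  proof -
    have "T3_chart (mask k t) \<in> W (Suc k)" for t
      using in_W[of "Suc k" "mask k t"] by (simp only: mask_Suc_mask)
    then have "W k \<subseteq> W (Suc k)"
      unfolding W_def[THEN fun_cong, of k]
      by (intro zariski_closure_minimal) (auto simp: W_def zariski_closed_closure)
    \<comment> \<open>The value 2 differs from the default 1 of coordinate 0 and is nonzero; the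
      products \<open>t 0 * t 2\<close> and \<open>t 0 * t 3\<close> become 4, hence the fact
      \<open>four\<close>.\<close>
    moreover have "T3_chart (mask (Suc k) (\<lambda>_. 2)) \<notin> W k"
    proof -
      have sep: "T3_chart (mask (Suc k) (\<lambda>_. 2)) \<notin> W k"
        if "p \<in> zpoly_fun" "\<And>t. p (T3_chart (mask k t)) = 0"
          "p (T3_chart (mask (Suc k) (\<lambda>_. 2))) \<noteq> 0" for p :: "'a struct3 \<Rightarrow> 'a"
      proof -
        have "W k \<subseteq> {x. p x = 0}"
          unfolding W_def using that(1,2)
          by (intro zariski_closure_minimal zariski_closed_zeros) auto
        then show ?thesis using that(3) by blast
      qed
      consider "k = 0" | "k = 1" | "k = 2" | "k = 3" using k by linarith
      then show ?thesis
      proof cases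
        case 1
        show ?thesis
          by (rule sep[of "\<lambda>\<mu>. \<mu> (0, 1, 0, 2) - 1"])
            (use 1 in \<open>simp_all add: T3_chart_entries mask_def zpoly_fun_diff zvar zconst\<close>)
      next
        case 2
        show ?thesis
          by (rule sep[of "\<lambda>\<mu>. \<mu> (0, 1, 1, 2)"])
            (use 2 two in \<open>simp_all add: T3_chart_entries mask_def zvar\<close>)
      next
        case 3
        show ?thesis
          by (rule sep[of "\<lambda>\<mu>. \<mu> (0, 1, 0, 0)"])
            (use 3 four in \<open>simp_all add: T3_chart_entries mask_def zvar\<close>)
      next
        case 4
        show ?thesis
          by (rule sep[of "\<lambda>\<mu>. \<mu> (0, 1, 0, 1)"])
            (use 4 four in \<open>simp_all add: T3_chart_entries mask_def zvar\<close>)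
      qed
    qed
    ultimately show ?thesis
      unfolding Z_def using in_W[of "Suc k" "\<lambda>_. 2"] nonzero[of "Suc k"] by blast
  qed
  ultimately show ?thesis unfolding irr_chain_def by blast
qed

theorem mainTheorem6:
  fixes F :: "'a::field itself"
  assumes "alg_closed TYPE('a)"
    and "(2::'a) \<noteq> 0"
  shows "zariski_irreducible (T3 :: 'a struct3 set)
       \<and> (T3 :: 'a struct3 set) = zariski_closure (orbit (T32 :: 'a struct3))
       \<and> rigid (T32 :: 'a struct3)
       \<and> zariski_dim (orbit (T32 :: 'a struct3)) = 4"
proof (intro conjI)
  note inf = infinite_UNIV_of_alg_closed[OF assms(1)]
  note orbit = orbit_T32[OF assms(2)]
  show irr: "zariski_irreducible (T3 :: 'a struct3 set)"
    unfolding T3_eq_range_param[OF assms(2)]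
    by (rule zariski_irreducible_range[OF inf zpoly_fun_T3_param])
  have ne: "\<not> (T3 :: 'a struct3 set) \<subseteq> {\<lambda>_. 0}"
  proof -
    have "T3_chart (\<lambda>_. 1 :: 'a) \<noteq> (\<lambda>_. 0)"
      using T3_chart_entries(1)[of "\<lambda>_. 1 :: 'a"] by auto
    then show ?thesis using T3_chart_in_T3 by blast
  qed
  show "(T3 :: 'a struct3 set) = zariski_closure (orbit (T32 :: 'a struct3))"
  proof
    let ?cl = "zariski_closure (orbit (T32 :: 'a struct3))"
    \<comment> \<open>Two closed sets cover the irreducible \<open>T3\<close>, and the zero system
      alone does not.\<close>
    have "T3 \<subseteq> ?cl \<union> {\<lambda>_. 0}"
      using zariski_closure_subset[of "orbit (T32 :: 'a struct3)"] unfolding orbit by blast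
    then show "T3 \<subseteq> ?cl"
      using irr ne zariski_closed_closure zariski_closed_zero unfolding zariski_irreducible_def by blast
    show "?cl \<subseteq> T3"
      by (rule zariski_closure_minimal[OF zariski_closed_T3[OF assms(2)] ]) (auto simp: orbit)
  qed
  show "rigid (T32 :: 'a struct3)"
    unfolding rigid_def rel_open_def orbit using zariski_closed_zero by blast
  show "zariski_dim (orbit (T32 :: 'a struct3)) = 4"
    unfolding zariski_dim_def
  proof (rule antisym)
    show "Sup {enat k |k. irr_chain (orbit (T32 :: 'a struct3)) k} \<le> 4"
      using irr_chain_orbit_T32_le[OF inf assms(2)]
      by (intro Sup_least) (auto simp: numeral_eq_enat)
    show "4 \<le> Sup {enat k |k. irr_chain (orbit (T32 :: 'a struct3)) k}"
      using irr_chain_orbit_T32[OF inf assms(2)]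
      by (intro Sup_upper) (auto simp: numeral_eq_enat)
  qed
qed

end
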